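(* Let $(\mathcal{V},\circ,\langle\cdot,\cdot\rangle)$ be a Euclidean Jordan algebra of rank $n$. Let $A$ be an $n\times n$ real symmetric matrix, fix a Jordan frame in $\mathcal{V}$, consider the Schur product $A\bullet x$ relative to this frame for $x\in\mathcal{V}$, and define the linear transformation $D_A:\mathcal{V}\to\mathcal{V}$ by $D_A(x):=A\bullet x$. Suppose the inequality $$\lambda\big(|A\bullet x|\big)\underset{w}{\prec}\lambda\big(|\mathrm{diag}(A)|\big)*\lambda\big(|x|\big)$$ holds for all $x\in\mathcal{V}$. Let $p,r,s\in[1,\infty]$ with $\frac1p=\frac1r+\frac1s$. Then $$\|A\bullet x\|_p\leq\|\mathrm{diag}(A)\|_r\,\|x\|_s\quad\text{for all }x\in\mathcal{V}.$$ Consequently, $$\|D_A\|_{r\to s}=\begin{cases}\|\mathrm{diag}(A)\|_\infty & \text{if } r\leq s,\\ \|\mathrm{diag}(A)\|_{\frac{rs}{r-s}} & \text{if } s<r.\end{cases}$$ In particular, when $A$ is positive semidefinite (with no further assumption on $A$), one has $\|A\bullet x\|_p\leq\|\mathrm{diag}(A)\|_r\,\|x\|_s$ for all $x\in\mathcal{V}$, and $\|D_A\|_{r\to s}=\|\mathrm{diag}(A)\|_\infty$ if $r\leq s$, while $\|D_A\|_{r\to s}=\|\mathrm{diag}(A)\|_{\frac{rs}{r-s}}$ if $s<r$.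
   Context: A Euclidean Jordan algebra $(\mathcal{V},\circ,\langle\cdot,\cdot\rangle)$ is a finite-dimensional real inner product space with a commutative bilinear product $\circ$ satisfying $x\circ(x^2\circ y)=x^2\circ(x\circ y)$ and $\langle x\circ y,z\rangle=\langle y,x\circ z\rangle$ (where $x^2=x\circ x$), with unit element $e$. A Jordan frame is a set $\{e_1,\dots,e_n\}$ of primitive idempotents with $e_i\circ e_j=0$ for $i\neq j$ and $\sum_i e_i=e$; the number $n$ is the rank of $\mathcal{V}$. Every $x\in\mathcal{V}$ has a spectral decomposition $x=x_1e_1+\cdots+x_ne_n$ for some Jordan frame, with the real numbers $x_i$ (the eigenvalues of $x$) uniquely determined up to order. $\lambda(x)\in\mathbb{R}^n$ denotes the vector of eigenvalues of $x$ in decreasing order, and $|x|:=\sum_i|x_i|e_i$. The inner product is the trace inner product $\langle x,y\rangle=\operatorname{tr}(x\circ y)$, where $\operatorname{tr}$ is the sum of eigenvalues. Schur product: given a Jordan frame $\{e_1,\dots,e_n\}$, one has the Peirce decomposition $\mathcal{V}=\sum_{i\leq j}\mathcal{V}_{ij}$ (orthogonal direct sum), where $\mathcal{V}_{ii}=\mathbb{R}e_i$ and $\mathcal{V}_{ij}=\{x: x\circ e_i=\tfrac12x=x\circ e_j\}$ for $i<j$. Writing $x=\sum_{i\leq j}x_{ij}$ with $x_{ij}\in\mathcal{V}_{ij}$, for a real symmetric $n\times n$ matrix $A=[a_{ij}]$ define $A\bullet x:=\sum_{i\leq j}a_{ij}x_{ij}$. $\mathrm{diag}(A)\in\mathbb{R}^n$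 is the vector of diagonal entries of $A$; for $q\in\mathbb{R}^n$, $|q|$ is the vector of absolute values of entries, and $\lambda(|\mathrm{diag}(A)|)$ is the decreasing rearrangement of $|\mathrm{diag}(A)|$. For $p,q\in\mathbb{R}^n$, $p*q$ is the componentwise product and $p^\downarrow$ the decreasing rearrangement of $p$. $p\underset{w}{\prec}q$ means $\sum_{i=1}^k p_i^\downarrow\leq\sum_{i=1}^k q_i^\downarrow$ for all $1\leq k\leq n$. Norms: for $p\in[1,\infty]$ and $x\in\mathcal{V}$, $\|x\|_p:=\|\lambda(x)\|_p$ is the spectral $p$-norm, the right side being the usual $p$-norm on $\mathbb{R}^n$; $\|\mathrm{diag}(A)\|_r$ is the usual $r$-norm on $\mathbb{R}^n$. For a linear $T:\mathcal{V}\to\mathcal{V}$, $\|T\|_{r\to s}:=\sup_{0\neq x\in\mathcal{V}}\frac{\|T(x)\|_s}{\|x\|_r}$. Conventions: $\frac1\infty=0$; for $s<r$ the exponent $\frac{rs}{r-s}$ is the number $t$ with $\frac1s=\frac1t+\frac1r$, so it equals $s$ when $r=\infty$. *)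

theory Defs
  imports
    "HOL-Analysis.Euclidean_Space"
    "HOL-Library.Extended_Real"
    "Jordan_Normal_Form.Matrix"
begin

class euclidean_jordan_algebra = euclidean_space +
  fixes jprod :: "'a \<Rightarrow> 'a \<Rightarrow> 'a"  (infixl "\<circ>\<^sub>J" 70)
    and junit :: 'a
  assumes jprod_commute: "x \<circ>\<^sub>J y = y \<circ>\<^sub>J x"
    and jprod_add_left: "(x + y) \<circ>\<^sub>J z = x \<circ>\<^sub>J z + y \<circ>\<^sub>J z"
    and jprod_scaleR_left: "(a *\<^sub>R x) \<circ>\<^sub>J y = a *\<^sub>R (x \<circ>\<^sub>J y)"
    and jordan_identity: "x \<circ>\<^sub>J ((x \<circ>\<^sub>J x) \<circ>\<^sub>J y) = (x \<circ>\<^sub>J x) \<circ>\<^sub>J (x \<circ>\<^sub>J y)"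
    and inner_jprod: "inner (x \<circ>\<^sub>J y) z = inner y (x \<circ>\<^sub>J z)"
    and jprod_junit: "junit \<circ>\<^sub>J x = x"

definition jidempotent :: "'a::euclidean_jordan_algebra \<Rightarrow> bool" where
  "jidempotent c \<longleftrightarrow> c \<circ>\<^sub>J c = c"

definition primitive_idempotent :: "'a::euclidean_jordan_algebra \<Rightarrow> bool" where
  "primitive_idempotent c \<longleftrightarrow> jidempotent c \<and> c \<noteq> 0 \<and>
     \<not> (\<exists>a b. jidempotent a \<and> jidempotent b \<and> a \<noteq> 0 \<and> b \<noteq> 0 \<and> c = a + b)"

definition jordan_frame :: "'a::euclidean_jordan_algebra set \<Rightarrow> bool" where
  "jordan_frame E \<longleftrightarrow> finite E \<and> (\<forall>c\<in>E. primitive_idempotent c) \<and>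
     (\<forall>c\<in>E. \<forall>d\<in>E. c \<noteq> d \<longrightarrow> c \<circ>\<^sub>J d = 0) \<and> (\<Sum>c\<in>E. c) = junit"

text \<open>A Jordan frame with a fixed numbering of its elements (starting at 0).\<close>

definition jordan_frame_list :: "'a::euclidean_jordan_algebra list \<Rightarrow> bool" where
  "jordan_frame_list cs \<longleftrightarrow> distinct cs \<and> jordan_frame (set cs)"

definition jrank :: "'a::euclidean_jordan_algebra itself \<Rightarrow> nat" where
  "jrank _ = (THE n. \<exists>E :: 'a set. jordan_frame E \<and> card E = n)"

definition spectral_decomp ::
    "'a::euclidean_jordan_algebra \<Rightarrow> real list \<Rightarrow> 'a list \<Rightarrow> bool" where
  "spectral_decomp x as cs \<longleftrightarrow> jordan_frame_list cs \<and> length as = length cs \<and>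
     x = (\<Sum>i<length cs. (as ! i) *\<^sub>R (cs ! i))"

text \<open>Vectors of \<open>\<real>\<^sup>n\<close> are lists of length \<open>n\<close>; \<open>eigvals x\<close> is the vector \<open>\<lambda>(x)\<close>.\<close>

definition eigvals :: "'a::euclidean_jordan_algebra \<Rightarrow> real list" where
  "eigvals x = (THE as. sorted_wrt (\<ge>) as \<and> (\<exists>cs. spectral_decomp x as cs))"

definition jtrace :: "'a::euclidean_jordan_algebra \<Rightarrow> real" where
  "jtrace x = sum_list (eigvals x)"

definition jabs :: "'a::euclidean_jordan_algebra \<Rightarrow> 'a" where
  "jabs x = (THE y. \<exists>as cs. spectral_decomp x as cs \<and>
     y = (\<Sum>i<length cs. \<bar>as ! i\<bar> *\<^sub>R (cs ! i)))"

definition peirce_space ::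
    "'a::euclidean_jordan_algebra list \<Rightarrow> nat \<Rightarrow> nat \<Rightarrow> 'a set" where
  "peirce_space cs i j =
     (if i = j then range (\<lambda>t. t *\<^sub>R (cs ! i))
      else {x. x \<circ>\<^sub>J (cs ! i) = (1/2) *\<^sub>R x \<and> x \<circ>\<^sub>J (cs ! j) = (1/2) *\<^sub>R x})"

definition peirce_decomp ::
    "'a::euclidean_jordan_algebra list \<Rightarrow> 'a \<Rightarrow> (nat \<Rightarrow> nat \<Rightarrow> 'a) \<Rightarrow> bool" where
  "peirce_decomp cs x X \<longleftrightarrow>
     (\<forall>j<length cs. \<forall>i\<le>j. X i j \<in> peirce_space cs i j) \<and>
     x = (\<Sum>j<length cs. \<Sum>i\<le>j. X i j)"

text \<open>The component \<open>x\<^sub>i\<^sub>j\<close>; meaningful for \<open>i \<le> j < length cs\<close>.\<close>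

definition peirce_component ::
    "'a::euclidean_jordan_algebra list \<Rightarrow> 'a \<Rightarrow> nat \<Rightarrow> nat \<Rightarrow> 'a" where
  "peirce_component cs x i j = (THE y. \<exists>X. peirce_decomp cs x X \<and> y = X i j)"

definition schur_product ::
    "'a::euclidean_jordan_algebra list \<Rightarrow> real mat \<Rightarrow> 'a \<Rightarrow> 'a" where
  "schur_product cs A x =
     (\<Sum>j<length cs. \<Sum>i\<le>j. (A $$ (i, j)) *\<^sub>R peirce_component cs x i j)"

definition psd_mat :: "real mat \<Rightarrow> bool" where
  "psd_mat A \<longleftrightarrow> A \<in> carrier_mat (dim_row A) (dim_row A) \<and> transpose_mat A = A \<and>
     (\<forall>v \<in> carrier_vec (dim_row A). 0 \<le> v \<bullet> (A *\<^sub>v v))"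

definition decreasing :: "real list \<Rightarrow> real list" where
  "decreasing p = rev (sort p)"

definition weakly_majorized :: "real list \<Rightarrow> real list \<Rightarrow> bool" where
  "weakly_majorized p q \<longleftrightarrow> length p = length q \<and>
     (\<forall>k\<in>{1..length p}. sum_list (take k (decreasing p)) \<le> sum_list (take k (decreasing q)))"

definition vec_norm :: "ereal \<Rightarrow> real list \<Rightarrow> real" where
  "vec_norm p v =
     (if p = \<infinity> then Max (abs ` set v)
      else (\<Sum>a\<leftarrow>v. \<bar>a\<bar> powr real_of_ereal p) powr (1 / real_of_ereal p))"

definition spectral_norm :: "ereal \<Rightarrow> 'a::euclidean_jordan_algebra \<Rightarrow> real" where
  "spectral_norm p x = vec_norm p (eigvals x)"

text \<open>The supremum is taken in the extended reals, so that an equation with a real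
  right-hand side includes the boundedness of the quotients.\<close>

definition spectral_opnorm ::
    "ereal \<Rightarrow> ereal \<Rightarrow> ('a::euclidean_jordan_algebra \<Rightarrow> 'a) \<Rightarrow> ereal" where
  "spectral_opnorm r s T =
     (SUP x \<in> {x. x \<noteq> 0}. ereal (spectral_norm s (T x) / spectral_norm r x))"

text \<open>The number \<open>t\<close> with \<open>1/s = 1/t + 1/r\<close>, for \<open>s < r\<close>. The case \<open>r = \<infinity>\<close> is separate
  because \<open>\<infinity> / \<infinity> = 0\<close> in \<^typ>\<open>ereal\<close>.\<close>

definition hoelder_exponent :: "ereal \<Rightarrow> ereal \<Rightarrow> ereal" where
  "hoelder_exponent r s = (if r = \<infinity> then s else r * s / (r - s))"

end

theory Submission
  imports Defs "HOL-Analysis.Convex_Euclidean_Space"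
begin

text \<open>
  Weak majorization between nonnegative vectors implies the inequality of their \<open>p\<close>-norms, so the norm inequality is the majorization
  hypothesis followed by Hoelder's inequality; equality in Hoelder's inequality is attained at elements that are
  diagonal in the given frame, which gives the operator norms.

  For positive semidefinite \<open>A\<close> the majorization is a consequence of \<open>D\<^sub>A\<close> being a positive map: with the spectral
  frames \<open>(f\<^sub>i)\<close> of \<open>A \<bullet> x\<close> and \<open>(g\<^sub>l)\<close> of \<open>x\<close>, the matrix \<open>\<langle>D\<^sub>A g\<^sub>l, f\<^sub>i\<rangle>\<close> is nonnegative, and its row and column sums
  are majorized by the diagonal of \<open>A\<close>. Since \<open>A\<close> is a sum of matrices \<open>v v\<^sup>T\<close>, positivity is needed only for these.
  For positive \<open>v\<close> the map \<open>D\<close> is a limit of powers of resolvents \<open>(I - L(z))\<^sup>-\<^sup>1\<close>, which are positive by a direct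
  eigenvalue computation, and signs of \<open>v\<close> are absorbed by the automorphism that negates the Peirce
  \<open>1/2\<close>-space of an idempotent.

  Eigenvalues are unique because primitive idempotents that are not orthogonal have the same norm, which makes the
  matrix of inner products of two frames doubly stochastic up to scaling.
\<close>

section \<open>Jordan products and idempotents\<close>

text \<open>Write L(x) for multiplication by \<open>x\<close> and e for the unit. The multiplier
  with entries v_i v_j is the quadratic representation 2 L(v)^2 - L(v^2) of v = sum v_i c_i, whose
  positivity is usually derived from the fundamental formula. The resolvents avoid that formula:
  L(z) acts on the Peirce space V_ij by (z_i + z_j)/2, so exp(L(z)) has the entries exp((z_i +
  z_j)/2), and z = 2 ln v turns them into v_i v_j. Since D is self-adjoint, the row sums <D g_l, e>
  are <g_l, D e> and the column sums are <D e, f_i>, where D e is diagonal in the given frame with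
  eigenvalues diag A. Both bounds thus become one statement: the partial sums of <D e, h_i> over a
  frame h are at most those of the ordered eigenvalues. As \<open>jtrace\<close> is defined through
  eigenvalues, their uniqueness has to be settled before the trace form can be used, for an inner
  product that is only associative. At that stage primitive idempotents may have different norms.
  Later the trace form gives them all norm 1.\<close>

lemma bounded_bilinear_jprod:
  "bounded_bilinear ((\<circ>\<^sub>J) :: 'a::euclidean_jordan_algebra \<Rightarrow> 'a \<Rightarrow> 'a)"
proof -
  have "bilinear ((\<circ>\<^sub>J) :: 'a \<Rightarrow> 'a \<Rightarrow> 'a)"
    unfolding bilinear_def
    by (intro conjI allI linearI)
      (metis jprod_add_left jprod_scaleR_left jprod_commute)+
  then show ?thesis by (simp add: bilinear_conv_bounded_bilinear)
qed

interpretation jprod: bounded_bilinear "(\<circ>\<^sub>J) :: 'a::euclidean_jordan_algebra \<Rightarrow> 'a \<Rightarrow> 'a"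
  by (rule bounded_bilinear_jprod)

lemmas jprod_simps = jprod.add_left jprod.add_right jprod.diff_left jprod.diff_right
  jprod.minus_left jprod.minus_right jprod.scaleR_left jprod.scaleR_right

lemma jprod_junit_right: "x \<circ>\<^sub>J junit = (x::'a::euclidean_jordan_algebra)"
  by (simp add: jprod_commute[of x] jprod_junit)

lemma junit_nonzero: "junit \<noteq> (0::'a::euclidean_jordan_algebra)"
proof
  assume "junit = (0::'a)"
  then have "x = 0" for x :: 'a using jprod_junit[of x] by (simp add: jprod.zero_left)
  then show False using nonzero_Basis nonempty_Basis by blast
qed

lemma inner_junit_jprod: "inner (x \<circ>\<^sub>J y) junit = inner x (y::'a::euclidean_jordan_algebra)"
  by (metis inner_jprod inner_commute jprod_junit_right)

lemma jprod_self_eq_0: "x \<circ>\<^sub>J x = 0 \<Longrightarrow> x = (0::'a::euclidean_jordan_algebra)"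
  using inner_junit_jprod[of x x] by simp

section \<open>Linearizations of the Jordan identity\<close>

lemma vector_eqI: "(\<And>b. inner x b = inner y b) \<Longrightarrow> x = (y::'a::real_inner)"
  by (metis vector_eq_rdot)

text \<open>Without a constant term, the values at 1, -1 and 2 determine all three coefficients;
  polarization uses the linear one.\<close>

lemma cubic_coeff_zero:
  fixes b c d :: "'a::real_inner"
  assumes "\<And>t::real. t *\<^sub>R b + (t*t) *\<^sub>R c + (t*t*t) *\<^sub>R d = 0"
  shows "b = 0"
proof (rule vector_eqI)
  fix v
  show "inner b v = inner 0 v"
    using arg_cong[OF assms[of 1], of "\<lambda>w. inner w v"]
      arg_cong[OF assms[of "-1"], of "\<lambda>w. inner w v"]
      arg_cong[OF assms[of 2], of "\<lambda>w. inner w v"]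
    by (simp add: inner_simps)
qed

text \<open>This is the derivative of the Jordan identity at \<open>x\<close> in direction
  \<open>z\<close>: the coefficient of t after \<open>x\<close> is replaced by x + t z.\<close>

lemma jordan_identity_polarized:
  fixes x y z :: "'a::euclidean_jordan_algebra"
  shows "(x \<circ>\<^sub>J x) \<circ>\<^sub>J (y \<circ>\<^sub>J z) + 2 *\<^sub>R ((x \<circ>\<^sub>J y) \<circ>\<^sub>J (x \<circ>\<^sub>J z))
    = z \<circ>\<^sub>J ((x \<circ>\<^sub>J x) \<circ>\<^sub>J y) + 2 *\<^sub>R (x \<circ>\<^sub>J ((x \<circ>\<^sub>J z) \<circ>\<^sub>J y))"
proof -
  let ?f = "\<lambda>w. (w \<circ>\<^sub>J w) \<circ>\<^sub>J (w \<circ>\<^sub>J y) - w \<circ>\<^sub>J ((w \<circ>\<^sub>J w) \<circ>\<^sub>J y)"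
  define b where "b = (x \<circ>\<^sub>J x) \<circ>\<^sub>J (z \<circ>\<^sub>J y) + 2 *\<^sub>R ((x \<circ>\<^sub>J z) \<circ>\<^sub>J (x \<circ>\<^sub>J y))
     - z \<circ>\<^sub>J ((x \<circ>\<^sub>J x) \<circ>\<^sub>J y) - 2 *\<^sub>R (x \<circ>\<^sub>J ((x \<circ>\<^sub>J z) \<circ>\<^sub>J y))"
  define c where "c = (z \<circ>\<^sub>J z) \<circ>\<^sub>J (x \<circ>\<^sub>J y) + 2 *\<^sub>R ((x \<circ>\<^sub>J z) \<circ>\<^sub>J (z \<circ>\<^sub>J y))
     - x \<circ>\<^sub>J ((z \<circ>\<^sub>J z) \<circ>\<^sub>J y) - 2 *\<^sub>R (z \<circ>\<^sub>J ((x \<circ>\<^sub>J z) \<circ>\<^sub>J y))"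
  have "t *\<^sub>R b + (t*t) *\<^sub>R c + (t*t*t) *\<^sub>R ?f z = 0" for t :: real
  proof -
    have "?f (x + t *\<^sub>R z) = ?f x + t *\<^sub>R b + (t*t) *\<^sub>R c + (t*t*t) *\<^sub>R ?f z"
      unfolding b_def c_def
      by (simp add: jprod_simps jprod_commute[of z x] algebra_simps scaleR_2)
    moreover have "?f w = 0" for w by (simp add: jordan_identity)
    ultimately show ?thesis by simp
  qed
  then have "b = 0" by (rule cubic_coeff_zero)
  then show ?thesis unfolding b_def
    by (simp add: jprod_commute[of z y] jprod_commute[of "x \<circ>\<^sub>J z" "x \<circ>\<^sub>J y"] algebra_simps)
qed

text \<open>The polarized identity read as operators on \<open>w\<close>: [L(x^2), L(z)] = 2
  [L(x), L(x z)].\<close>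

lemma commutator_square:
  fixes x z w :: "'a::euclidean_jordan_algebra"
  shows "(x \<circ>\<^sub>J x) \<circ>\<^sub>J (z \<circ>\<^sub>J w) - z \<circ>\<^sub>J ((x \<circ>\<^sub>J x) \<circ>\<^sub>J w)
    = 2 *\<^sub>R (x \<circ>\<^sub>J ((x \<circ>\<^sub>J z) \<circ>\<^sub>J w) - (x \<circ>\<^sub>J z) \<circ>\<^sub>J (x \<circ>\<^sub>J w))"
  using jordan_identity_polarized[of x w z]
  by (simp add: jprod_commute[of w z] jprod_commute[of "x \<circ>\<^sub>J w"] algebra_simps)

text \<open>The same identity read as operators on \<open>z\<close>: L(x^2 y) = L(x^2) L(y) + 2 L(x
  y) L(x) - 2 L(x) L(y) L(x). It drives the recursion for powers and the cubic equation of an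
  idempotent.\<close>

lemma jprod_square_mult:
  fixes x y z :: "'a::euclidean_jordan_algebra"
  shows "(y \<circ>\<^sub>J (x \<circ>\<^sub>J x)) \<circ>\<^sub>J z = (x \<circ>\<^sub>J x) \<circ>\<^sub>J (y \<circ>\<^sub>J z) + 2 *\<^sub>R ((x \<circ>\<^sub>J y) \<circ>\<^sub>J (x \<circ>\<^sub>J z))
     - 2 *\<^sub>R (x \<circ>\<^sub>J (y \<circ>\<^sub>J (x \<circ>\<^sub>J z)))"
  using jordan_identity_polarized[of x y z]
  by (simp add: jprod_commute[of z] jprod_commute[of y "x \<circ>\<^sub>J x"] jprod_commute[of y "x \<circ>\<^sub>J z"] algebra_simps)

text \<open>The polynomials 2t^2 - t here and 4(t - t^2) in \<open>peirce_half\<close> take the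
  values (1, 0, 0) and (0, 1, 0) at t = 1, 1/2, 0, the possible eigenvalues of L(c) for an
  idempotent. Hence they give the projections onto the Peirce 1- and 1/2-spaces.\<close>

definition peirce_one :: "'a::euclidean_jordan_algebra \<Rightarrow> 'a \<Rightarrow> 'a" where
  "peirce_one c x = 2 *\<^sub>R (c \<circ>\<^sub>J (c \<circ>\<^sub>J x)) - c \<circ>\<^sub>J x"

definition peirce_half :: "'a::euclidean_jordan_algebra \<Rightarrow> 'a \<Rightarrow> 'a" where
  "peirce_half c x = 4 *\<^sub>R (c \<circ>\<^sub>J x - c \<circ>\<^sub>J (c \<circ>\<^sub>J x))"

text \<open>With x = y = c the formula for L(x^2 y) becomes L = 3 L^2 - 2 L^3, so the eigenvalues of
  L(c) lie in {0, 1/2, 1}.\<close>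

lemma idempotent_cubic:
  fixes c z :: "'a::euclidean_jordan_algebra"
  assumes "jidempotent c"
  shows "2 *\<^sub>R (c \<circ>\<^sub>J (c \<circ>\<^sub>J (c \<circ>\<^sub>J z))) = 3 *\<^sub>R (c \<circ>\<^sub>J (c \<circ>\<^sub>J z)) - c \<circ>\<^sub>J z"
proof -
  have cc: "c \<circ>\<^sub>J c = c" using assms by (simp add: jidempotent_def)
  show ?thesis
  proof (rule vector_eqI)
    fix b
    show "inner (2 *\<^sub>R (c \<circ>\<^sub>J (c \<circ>\<^sub>J (c \<circ>\<^sub>J z)))) b
      = inner (3 *\<^sub>R (c \<circ>\<^sub>J (c \<circ>\<^sub>J z)) - c \<circ>\<^sub>J z) b"
      using arg_cong[OF jprod_square_mult[of c c z], of "\<lambda>w. inner w b"]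
      by (simp add: cc inner_diff_left inner_add_left)
  qed
qed

lemma jprod_peirce_one:
  assumes "jidempotent c"
  shows "c \<circ>\<^sub>J peirce_one c x = peirce_one c x"
proof (rule vector_eqI)
  fix b
  show "inner (c \<circ>\<^sub>J peirce_one c x) b = inner (peirce_one c x) b"
    using arg_cong[OF idempotent_cubic[OF assms, of x], of "\<lambda>w. inner w b"]
    by (simp add: peirce_one_def jprod_simps inner_diff_left)
qed

lemma jprod_peirce_half:
  assumes "jidempotent c"
  shows "c \<circ>\<^sub>J peirce_half c x = (1/2) *\<^sub>R peirce_half c x"
proof (rule vector_eqI)
  fix b
  show "inner (c \<circ>\<^sub>J peirce_half c x) b = inner ((1/2) *\<^sub>R peirce_half c x) b"
    using arg_cong[OF idempotent_cubic[OF assms, of x], of "\<lambda>w. inner w b"]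
    by (simp add: peirce_half_def jprod_simps inner_diff_left)
qed

lemma jprod_idempotent_decomp:
  "c \<circ>\<^sub>J x = peirce_one c x + (1/2) *\<^sub>R peirce_half c x"
  by (rule vector_eqI) (simp add: peirce_half_def peirce_one_def inner_simps)

lemma peirce_one_eqI: "c \<circ>\<^sub>J x = x \<Longrightarrow> peirce_one c x = x"
  by (simp add: peirce_one_def scaleR_2)

text \<open>Both Peirce projections are self-adjoint and idempotent, and L(c) is the first plus half
  the second. The form is thus a sum of squares: nonnegative, and zero only where L(c)
  vanishes.\<close>

lemma idempotent_form:
  fixes c x :: "'a::euclidean_jordan_algebra"
  assumes c: "jidempotent c"
  shows "inner (c \<circ>\<^sub>J x) x
    = inner (peirce_one c x) (peirce_one c x) + inner (peirce_half c x) (peirce_half c x) / 2"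
proof -
  have sym: "inner (c \<circ>\<^sub>J u) v = inner u (c \<circ>\<^sub>J v)" for u v :: 'a by (rule inner_jprod)
  have 1: "inner (peirce_one c u) v = inner u (peirce_one c v)" for u v
    by (simp add: peirce_one_def inner_diff_left inner_diff_right sym)
  have 2: "inner (peirce_half c u) v = inner u (peirce_half c v)" for u v
    by (simp add: peirce_half_def inner_diff_left inner_diff_right sym)
  have "peirce_one c (peirce_one c x) = peirce_one c x"
    by (simp add: peirce_one_eqI jprod_peirce_one c)
  then have 3: "inner (peirce_one c x) x = inner (peirce_one c x) (peirce_one c x)"
    by (metis 1)
  have "peirce_half c (peirce_half c x) = peirce_half c x"
    unfolding peirce_half_def[of c "peirce_half c x"]
    by (simp add: jprod_peirce_half c jprod_simps flip: scaleR_left_diff_distrib)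
  then have 4: "inner (peirce_half c x) x = inner (peirce_half c x) (peirce_half c x)"
    by (metis 2)
  show ?thesis
    by (subst jprod_idempotent_decomp) (simp add: inner_add_left 3 4)
qed

lemma idempotent_nonneg_form: "jidempotent c \<Longrightarrow> 0 \<le> inner (c \<circ>\<^sub>J x) x"
  by (simp add: idempotent_form)

lemma idempotent_form_eq_0:
  assumes "jidempotent c" "inner (c \<circ>\<^sub>J x) x = 0"
  shows "c \<circ>\<^sub>J x = 0"
proof -
  have "inner (peirce_one c x) (peirce_one c x) + inner (peirce_half c x) (peirce_half c x) / 2 = 0"
    using assms by (simp add: idempotent_form)
  then have "peirce_one c x = 0 \<and> peirce_half c x = 0"
    using inner_ge_zero[of "peirce_one c x"] inner_ge_zero[of "peirce_half c x"]
    by (metis (no_types, opaque_lifting) add_nonneg_eq_0_iff divide_eq_0_iff divide_nonneg_pos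
        inner_eq_zero_iff zero_less_numeral zero_neq_numeral)
  then show ?thesis by (simp add: jprod_idempotent_decomp)
qed

text \<open>As \<open>d\<close> equals its own square, associativity rewrites <c, d> as <c d, d>, a
  value of the nonnegative form of L(c).\<close>

lemma idempotent_inner_nonneg:
  fixes c d :: "'a::euclidean_jordan_algebra"
  assumes "jidempotent c" "jidempotent d"
  shows "0 \<le> inner c d"
  using idempotent_nonneg_form[OF assms(1), of d] assms(2)
  by (simp add: jidempotent_def jprod_commute[of c d] inner_jprod[of d c d])

lemma idempotent_inner_junit: "jidempotent c \<Longrightarrow> inner c junit = inner c c"
  using inner_junit_jprod[of c c] by (simp add: jidempotent_def)

text \<open>The commutator [L(c), L(d)] equals 2 [L(c), L(c d)], which vanishes here.\<close>

lemma idempotent_orthogonal_jprod: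
  fixes c d :: "'a::euclidean_jordan_algebra"
  assumes c: "jidempotent c" and cd: "c \<circ>\<^sub>J d = 0"
  shows "c \<circ>\<^sub>J (d \<circ>\<^sub>J x) = d \<circ>\<^sub>J (c \<circ>\<^sub>J x)"
proof -
  have "c \<circ>\<^sub>J c = c" using c by (simp add: jidempotent_def)
  then show ?thesis using commutator_square[of c d x] by (simp add: cd jprod.zero_left jprod.zero_right)
qed

text \<open>For c y = y the commutator identity reads [L(c), L(y)] = 2 [L(c), L(y)].\<close>

lemma peirce_one_commute:
  fixes c y :: "'a::euclidean_jordan_algebra"
  assumes c: "jidempotent c" and cy: "c \<circ>\<^sub>J y = y"
  shows "c \<circ>\<^sub>J (y \<circ>\<^sub>J x) = y \<circ>\<^sub>J (c \<circ>\<^sub>J x)"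
proof (rule vector_eqI)
  fix b
  have "c \<circ>\<^sub>J c = c" using c by (simp add: jidempotent_def)
  then show "inner (c \<circ>\<^sub>J (y \<circ>\<^sub>J x)) b = inner (y \<circ>\<^sub>J (c \<circ>\<^sub>J x)) b"
    using arg_cong[OF commutator_square[of c y x], of "\<lambda>w. inner w b"]
    by (simp add: cy inner_diff_left)
qed

text \<open>Commuting L(c) past \<open>y\<close> puts the product into the Peirce 0-space, past
  \<open>z\<close> into the 1-space; these meet in 0.\<close>

lemma peirce_one_zero_orthogonal:
  fixes c y :: "'a::euclidean_jordan_algebra"
  assumes c: "jidempotent c" and cy: "c \<circ>\<^sub>J y = y" and cz: "c \<circ>\<^sub>J z = 0"
  shows "y \<circ>\<^sub>J z = 0"
proof -
  have "c \<circ>\<^sub>J (y \<circ>\<^sub>J z) = 0"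
    using peirce_one_commute[OF c cy, of z] by (simp add: cz jprod.zero_right)
  moreover have "c \<circ>\<^sub>J (z \<circ>\<^sub>J y) = z \<circ>\<^sub>J y"
    using idempotent_orthogonal_jprod[OF c cz, of y] by (simp add: cy)
  ultimately show ?thesis by (simp add: jprod_commute)
qed

section \<open>Primitive idempotents and orthogonal systems\<close>

lemma jidempotent_diff:
  fixes c g :: "'a::euclidean_jordan_algebra"
  assumes "jidempotent c" "jidempotent g" "c \<circ>\<^sub>J g = g"
  shows "jidempotent (c - g)"
  using assms by (simp add: jidempotent_def jprod_simps jprod_commute[of g c])

lemma primitive_idempotent_below:
  fixes c g :: "'a::euclidean_jordan_algebra"
  assumes "primitive_idempotent c" "jidempotent g" "c \<circ>\<^sub>J g = g"
  shows "g = 0 \<or> g = c"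
proof (rule ccontr)
  assume "\<not> ?thesis"
  then have "g \<noteq> 0" "c - g \<noteq> 0" "c = g + (c - g)" by auto
  moreover have "jidempotent (c - g)"
    using assms jidempotent_diff by (auto simp: primitive_idempotent_def)
  ultimately show False using assms unfolding primitive_idempotent_def by blast
qed

lemma jidempotent_sum_orthogonal:
  fixes a b :: "'a::euclidean_jordan_algebra"
  assumes "jidempotent a" "jidempotent b" "jidempotent (a + b)"
  shows "a \<circ>\<^sub>J b = 0"
proof -
  have "2 *\<^sub>R (a \<circ>\<^sub>J b) = 0"
    using assms by (simp add: jidempotent_def jprod_simps jprod_commute[of b a] scaleR_2 algebra_simps)
  then show ?thesis by simp
qed

lemma primitive_idempotentD:
  "primitive_idempotent c \<Longrightarrow> jidempotent c" "primitive_idempotent c \<Longrightarrow> c \<noteq> 0"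
  by (auto simp: primitive_idempotent_def)

definition orthogonal_idempotents :: "'a::euclidean_jordan_algebra set \<Rightarrow> bool" where
  "orthogonal_idempotents C \<longleftrightarrow> (\<forall>c\<in>C. jidempotent c \<and> c \<noteq> 0) \<and>
     (\<forall>c\<in>C. \<forall>d\<in>C. c \<noteq> d \<longrightarrow> c \<circ>\<^sub>J d = 0)"

lemma orthogonal_idempotents_inner:
  assumes "orthogonal_idempotents C" "c \<in> C" "d \<in> C" "c \<noteq> d"
  shows "inner c d = 0"
  using assms inner_junit_jprod[of c d] by (simp add: orthogonal_idempotents_def)

text \<open>Distinct members are nonzero and orthogonal for the inner product, hence independent.
  The bound makes a system of maximal size exist.\<close>

lemma orthogonal_idempotents_card:
  fixes C :: "'a::euclidean_jordan_algebra set"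
  assumes "orthogonal_idempotents C"
  shows "finite C" "card C \<le> DIM('a)"
proof -
  have "independent C"
    using assms
    by (intro pairwise_orthogonal_independent)
      (auto simp: pairwise_def orthogonal_def orthogonal_idempotents_inner orthogonal_idempotents_def)
  then show "finite C" "card C \<le> DIM('a)" using independent_bound by blast+
qed

lemma jprod_orthogonal_sum:
  assumes "orthogonal_idempotents C" "finite D" "D \<subseteq> C" "c \<in> C"
  shows "c \<circ>\<^sub>J (\<Sum>d\<in>D. f d *\<^sub>R d) = (if c \<in> D then f c *\<^sub>R c else 0)"
proof -
  have "c \<circ>\<^sub>J (\<Sum>d\<in>D. f d *\<^sub>R d) = (\<Sum>d\<in>D. f d *\<^sub>R (c \<circ>\<^sub>J d))"
    by (simp add: jprod.sum_right jprod.scaleR_right)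
  also have "\<dots> = (\<Sum>d\<in>D. if d = c then f c *\<^sub>R c else 0)"
    using assms by (intro sum.cong) (auto simp: orthogonal_idempotents_def jidempotent_def subset_iff)
  finally show ?thesis using assms by simp
qed

section \<open>Powers and power associativity\<close>

definition jpower :: "'a::euclidean_jordan_algebra \<Rightarrow> nat \<Rightarrow> 'a" where
  "jpower x k = (((\<circ>\<^sub>J) x) ^^ k) junit"

lemma jpower_0: "jpower x 0 = junit" and jpower_Suc: "jpower x (Suc k) = x \<circ>\<^sub>J jpower x k"
  by (simp_all add: jpower_def)

lemma square_jpower: "(x \<circ>\<^sub>J x) \<circ>\<^sub>J jpower x k = jpower x (Suc (Suc k))"
proof (induction k)
  case 0 show ?case by (simp add: jpower_0 jpower_Suc jprod_junit_right)
next
  case (Suc k) then show ?case by (simp add: jpower_Suc flip: jordan_identity)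
qed

text \<open>L(x^(k+2)) is an expression in L(x), L(x^2), L(x^k) and L(x^(k+1)), so whatever commutes
  with L(x) and L(x^2) commutes with every L(x^k).\<close>

lemma jpower_commutant:
  fixes S :: "'a::euclidean_jordan_algebra \<Rightarrow> 'a"
  assumes S: "linear S" "\<And>y. S (x \<circ>\<^sub>J y) = x \<circ>\<^sub>J S y" "\<And>y. S ((x \<circ>\<^sub>J x) \<circ>\<^sub>J y) = (x \<circ>\<^sub>J x) \<circ>\<^sub>J S y"
  shows "S (jpower x k \<circ>\<^sub>J y) = jpower x k \<circ>\<^sub>J S y"
proof (induction k arbitrary: y rule: induct_nat_012)
  case 0 show ?case by (simp add: jpower_0 jprod_junit)
next
  case 1 show ?case by (simp add: jpower_0 jpower_Suc jprod_junit_right S)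
next
  case (ge2 k)
  have *: "jpower x (Suc (Suc k)) \<circ>\<^sub>J y = (x \<circ>\<^sub>J x) \<circ>\<^sub>J (jpower x k \<circ>\<^sub>J y)
      + 2 *\<^sub>R (jpower x (Suc k) \<circ>\<^sub>J (x \<circ>\<^sub>J y)) - 2 *\<^sub>R (x \<circ>\<^sub>J (jpower x k \<circ>\<^sub>J (x \<circ>\<^sub>J y)))" for y
    using jprod_square_mult[of "jpower x k" x y]
    by (simp add: jprod_commute[of "jpower x k" "x \<circ>\<^sub>J x"] square_jpower flip: jpower_Suc)
  show ?case unfolding * using S(1) by (simp add: linear_add linear_diff linear_scale S ge2)
qed

lemma linear_jprod: "linear ((\<circ>\<^sub>J) (x::'a::euclidean_jordan_algebra))"
  using jprod.bounded_linear_right bounded_linear.linear by blast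

text \<open>The commutant lemma is applied first to S = L(x) and S = L(x^2), which commute by the
  Jordan identity, and then to S = L(x^m) itself.\<close>

lemma jpower_commute:
  "jpower x m \<circ>\<^sub>J (jpower x k \<circ>\<^sub>J y) = jpower x k \<circ>\<^sub>J (jpower x m \<circ>\<^sub>J y)"
proof -
  have 1: "x \<circ>\<^sub>J (jpower x m \<circ>\<^sub>J y) = jpower x m \<circ>\<^sub>J (x \<circ>\<^sub>J y)" for m y
    by (rule jpower_commutant[OF linear_jprod]) (simp_all add: jordan_identity)
  have 2: "(x \<circ>\<^sub>J x) \<circ>\<^sub>J (jpower x m \<circ>\<^sub>J y) = jpower x m \<circ>\<^sub>J ((x \<circ>\<^sub>J x) \<circ>\<^sub>J y)" for m y
    by (rule jpower_commutant[OF linear_jprod]) (simp_all add: jordan_identity)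
  show ?thesis
    by (rule jpower_commutant[OF linear_jprod]) (simp_all add: 1 2)
qed

lemma jpower_add: "jpower x m \<circ>\<^sub>J jpower x k = jpower x (m + k)"
proof (induction k)
  case 0 show ?case by (simp add: jpower_0 jprod_junit_right)
next
  case (Suc k)
  have "jpower x m \<circ>\<^sub>J (jpower x 1 \<circ>\<^sub>J jpower x k) = jpower x 1 \<circ>\<^sub>J (jpower x m \<circ>\<^sub>J jpower x k)"
    by (rule jpower_commute)
  then show ?case using Suc by (simp add: jpower_0 jpower_Suc jprod_junit_right)
qed

section \<open>The spectral theorem\<close>

text \<open>A minimizer of the Rayleigh quotient on the unit sphere of \<open>I\<close> is an
  eigenvector: its residual \<open>g\<close> lies in \<open>I\<close>, and moving against
  \<open>g\<close> would make the shifted form \<open>q\<close> negative unless \<open>g\<close> is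
  0.\<close>

lemma symmetric_eigenvector:
  fixes L :: "'a::euclidean_space \<Rightarrow> 'a"
  assumes L: "linear L" and sym: "\<And>u v. inner (L u) v = inner u (L v)"
    and I: "subspace I" "I \<noteq> {0}" and LI: "\<And>w. w \<in> I \<Longrightarrow> L w \<in> I"
  obtains w \<mu> where "w \<in> I" "w \<noteq> 0" "L w = \<mu> *\<^sub>R w"
proof -
  let ?S = "I \<inter> sphere 0 1"
  obtain v where v: "v \<in> I" "v \<noteq> 0" using I subspace_0 by blast
  then have "(1 / norm v) *\<^sub>R v \<in> ?S" using I(1) by (simp add: subspace_scale)
  then have ne: "?S \<noteq> {}" by blast
  have cpt: "compact ?S" using I(1) by (simp add: closed_Int_compact closed_subspace)
  have "continuous_on ?S (\<lambda>w. inner (L w) w)"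
    using L by (intro continuous_intros linear_continuous_on) (simp add: linear_conv_bounded_linear)
  then obtain w where w: "w \<in> ?S" and min: "\<And>v. v \<in> ?S \<Longrightarrow> inner (L w) w \<le> inner (L v) v"
    using continuous_attains_inf[OF cpt ne] by blast
  define \<mu> where "\<mu> = inner (L w) w"
  define q where "q v = inner (L v - \<mu> *\<^sub>R v) v" for v
  have q: "0 \<le> q v" if "v \<in> I" for v
  proof (cases "v = 0")
    case False
    let ?u = "(1 / norm v) *\<^sub>R v"
    have "?u \<in> ?S" using I(1) that False by (simp add: subspace_scale)
    then have "\<mu> \<le> inner (L ?u) ?u" unfolding \<mu>_def by (rule min)
    also have "\<dots> = inner (L v) v / (norm v * norm v)"
      using L by (simp add: linear_scale)
    finally show ?thesis
      using False by (simp add: q_def inner_diff_left field_simps flip: power2_norm_eq_inner power2_eq_square)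
  qed (simp add: q_def)
  define g where "g = L w - \<mu> *\<^sub>R w"
  have gI: "g \<in> I" unfolding g_def using w LI I(1) by (simp add: subspace_diff subspace_scale)
  have nw: "inner w w = 1" using w by (simp add: norm_eq_sqrt_inner)
  have qs: "q (w - s *\<^sub>R g) = s * s * q g - 2 * s * inner g g" for s
  proof -
    have "q (w - s *\<^sub>R g) = q w - 2 * s * inner (L w - \<mu> *\<^sub>R w) g + s * s * q g"
      using L sym[of w g]
      by (simp add: q_def linear_diff linear_scale inner_simps algebra_simps inner_commute)
    moreover have "q w = 0" by (simp add: q_def inner_diff_left nw \<mu>_def)
    ultimately show ?thesis by (simp add: g_def)
  qed
  have "g = 0"
  proof (rule ccontr)
    assume "g \<noteq> 0"
    then have pos: "0 < inner g g" by simp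
    \<comment> \<open>Any positive s with s q(g) < 2 |g|^2 contradicts nonnegativity of
      \<open>q\<close> at w - s g; the added 1 avoids division by zero.\<close>
    define s where "s = inner g g / (q g + 1)"
    have qg: "0 \<le> q g" using q gI by blast
    have s: "0 < s" using pos qg by (simp add: s_def)
    have "w - s *\<^sub>R g \<in> I" using w gI I(1) by (simp add: subspace_diff subspace_scale)
    then have "0 \<le> s * (s * q g - 2 * inner g g)" using q[of "w - s *\<^sub>R g"] qs[of s] by (simp add: algebra_simps)
    then have "2 * inner g g \<le> s * q g" using s by (simp add: zero_le_mult_iff)
    also have "\<dots> \<le> s * (q g + 1)" using s by simp
    also have "\<dots> = inner g g" using qg by (simp add: s_def)
    finally show False using pos by simp
  qed
  moreover have "w \<noteq> 0" using nw by auto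
  ultimately show ?thesis using that[of w \<mu>] w unfolding g_def by auto
qed

text \<open>Given commutativity, the third assumption is associativity on \<open>W\<close>. A
  nonzero ideal of least dimension yields an idempotent, and the induction continues on its
  annihilator in \<open>W\<close>.\<close>

lemma associative_subspace_idempotents:
  fixes W :: "'a::euclidean_jordan_algebra set"
  assumes "subspace W" "\<And>u v. u \<in> W \<Longrightarrow> v \<in> W \<Longrightarrow> u \<circ>\<^sub>J v \<in> W"
    and "\<And>u v w. u \<in> W \<Longrightarrow> v \<in> W \<Longrightarrow> w \<in> W \<Longrightarrow> u \<circ>\<^sub>J (v \<circ>\<^sub>J w) = v \<circ>\<^sub>J (u \<circ>\<^sub>J w)"
  shows "\<exists>C. orthogonal_idempotents C \<and> C \<subseteq> W \<and> W \<subseteq> span C"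
  using assms
proof (induction "dim W" arbitrary: W rule: less_induct)
  case less
  note sub = less.prems(1) and closed = less.prems(2) and comm = less.prems(3)
  show ?case
  proof (cases "W = {0}")
    case True
    then show ?thesis by (intro exI[of _ "{}"]) (simp add: orthogonal_idempotents_def)
  next
    case False
    define ideal where "ideal I \<longleftrightarrow> subspace I \<and> I \<subseteq> W \<and> I \<noteq> {0} \<and> (\<forall>u\<in>W. \<forall>w\<in>I. u \<circ>\<^sub>J w \<in> I)" for I
    have "ideal W" using sub closed False by (simp add: ideal_def)
    then obtain I where I: "ideal I" and least: "\<And>J. ideal J \<Longrightarrow> dim I \<le> dim J"
      using ex_has_least_nat[of ideal W dim] by blast
    have Isub: "subspace I" and IW: "I \<subseteq> W" and Ine: "I \<noteq> {0}"
      and II: "\<And>u w. u \<in> W \<Longrightarrow> w \<in> I \<Longrightarrow> u \<circ>\<^sub>J w \<in> I"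
      using I by (auto simp: ideal_def)
    \<comment> \<open>An eigenspace of L(u) inside \<open>I\<close> is again an ideal because
      multiplications on \<open>W\<close> commute. By minimality it is all of \<open>I\<close>, so
      every \<open>u\<close> acts on \<open>I\<close> as a scalar.\<close>
    have "\<exists>\<mu>. \<forall>w\<in>I. u \<circ>\<^sub>J w = \<mu> *\<^sub>R w" if u: "u \<in> W" for u
    proof -
      obtain w \<mu> where w: "w \<in> I" "w \<noteq> 0" "u \<circ>\<^sub>J w = \<mu> *\<^sub>R w"
        using symmetric_eigenvector[OF linear_jprod inner_jprod Isub Ine II[OF u]] by blast
      let ?J = "{w \<in> I. u \<circ>\<^sub>J w = \<mu> *\<^sub>R w}"
      have J: "subspace ?J"
        using Isub by (auto simp: subspace_def jprod_simps jprod.zero_right scaleR_right_distrib)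
      have "v \<circ>\<^sub>J w \<in> ?J" if "v \<in> W" "w \<in> ?J" for v w
        using that II comm[of u v w] u IW by (auto simp: jprod.scaleR_right)
      then have "ideal ?J" using J w IW by (auto simp: ideal_def)
      then have "dim I \<le> dim ?J" by (rule least)
      then have "?J = I" using subspace_dim_equal[OF J Isub] by auto
      then show ?thesis by blast
    qed
    then obtain \<kappa> where \<kappa>: "\<And>u w. u \<in> W \<Longrightarrow> w \<in> I \<Longrightarrow> u \<circ>\<^sub>J w = \<kappa> u *\<^sub>R w" by metis
    obtain w where w: "w \<in> I" "w \<noteq> 0" using Ine Isub subspace_0 by blast
    have ww: "w \<circ>\<^sub>J w = \<kappa> w *\<^sub>R w" using \<kappa> w IW by blast
    \<comment> \<open>A zero square would give <w, w> = <w w, e> = 0; so \<open>w\<close> can be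
      rescaled to an idempotent.\<close>
    then have \<kappa>0: "\<kappa> w \<noteq> 0" using jprod_self_eq_0[of w] w by auto
    define c where "c = (1 / \<kappa> w) *\<^sub>R w"
    have cI: "c \<in> I" unfolding c_def using w Isub by (simp add: subspace_scale)
    have c: "jidempotent c" "c \<noteq> 0"
      using \<kappa>0 w by (auto simp: jidempotent_def c_def jprod_simps ww)
    let ?W = "{u \<in> W. c \<circ>\<^sub>J u = 0}"
    have W': "subspace ?W"
      using sub by (auto simp: subspace_def jprod_simps jprod.zero_right)
    have cW: "c \<in> W" using cI IW by blast
    have "c \<notin> ?W" using c by (simp add: jidempotent_def)
    then have "?W \<noteq> W" using cW by blast
    then have "dim ?W < dim W"
      using subspace_dim_equal[OF W' sub] dim_subset[of ?W W] by (force simp: not_less[symmetric])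
    moreover have "u \<circ>\<^sub>J v \<in> ?W" if "u \<in> ?W" "v \<in> ?W" for u v
      using that closed comm[of c u v] cW by (auto simp: jprod.zero_right)
    ultimately obtain C where C: "orthogonal_idempotents C" "C \<subseteq> ?W" "?W \<subseteq> span C"
      using less.hyps[of ?W] W' comm by blast
    have "orthogonal_idempotents (insert c C)"
      using C(1,2) c by (auto simp: orthogonal_idempotents_def jprod_commute)
    moreover have "W \<subseteq> span (insert c C)"
    proof
      fix u assume u: "u \<in> W"
      have uc: "u \<circ>\<^sub>J c = \<kappa> u *\<^sub>R c" using \<kappa> u cI by blast
      have "u - \<kappa> u *\<^sub>R c \<in> ?W"
        using u cW sub uc c(1) by (simp add: subspace_diff subspace_scale jprod_simps jidempotent_def jprod_commute[of c u])
      then have "u - \<kappa> u *\<^sub>R c \<in> span (insert c C)" using C(3) span_mono[of C "insert c C"] by blast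
      moreover have "\<kappa> u *\<^sub>R c \<in> span (insert c C)" by (simp add: span_scale span_base)
      ultimately have "(u - \<kappa> u *\<^sub>R c) + \<kappa> u *\<^sub>R c \<in> span (insert c C)" by (rule span_add)
      then show "u \<in> span (insert c C)" by simp
    qed
    ultimately show ?thesis using C(2) cW by (intro exI[of _ "insert c C"]) auto
  qed
qed

text \<open>Two exponent sets occur: all exponents, so that the span contains \<open>junit\<close>,
  and the positive ones, so that for an element of a Peirce 1-space the span stays in that
  space.\<close>

lemma jpower_span_idempotents:
  fixes x :: "'a::euclidean_jordan_algebra"
  assumes N: "\<And>m k. m \<in> N \<Longrightarrow> k \<in> N \<Longrightarrow> m + k \<in> N"
  shows "\<exists>C. orthogonal_idempotents C \<and> C \<subseteq> span (jpower x ` N) \<and> jpower x ` N \<subseteq> span C"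
proof -
  let ?W = "span (jpower x ` N)"
  have *: "u \<circ>\<^sub>J v \<in> ?W" if u: "u \<in> ?W" and v: "v \<in> ?W" for u v
    using u
  proof (induction u rule: span_induct)
    case base
    show ?case by (auto simp: subspace_def jprod_simps jprod.zero_left span_0 intro: span_add span_scale)
  next
    case (step a)
    show ?case using v
    proof (induction v rule: span_induct)
      case base
      show ?case by (auto simp: subspace_def jprod_simps jprod.zero_right span_0 intro: span_add span_scale)
    next
      case (step b)
      then show ?case using \<open>a \<in> jpower x ` N\<close> N by (auto simp: jpower_add intro: span_base)
    qed
  qed
  have "u \<circ>\<^sub>J (v \<circ>\<^sub>J w) = v \<circ>\<^sub>J (u \<circ>\<^sub>J w)" if u: "u \<in> ?W" and v: "v \<in> ?W" for u v w
    using u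
  proof (induction u rule: span_induct)
    case base
    show ?case by (auto simp: subspace_def jprod_simps jprod.zero_left jprod.zero_right)
  next
    case (step a)
    show ?case using v
    proof (induction v rule: span_induct)
      case base
      show ?case by (auto simp: subspace_def jprod_simps jprod.zero_left jprod.zero_right)
    next
      case (step b)
      then show ?case using \<open>a \<in> jpower x ` N\<close> by (auto simp: jpower_commute)
    qed
  qed
  then obtain C where "orthogonal_idempotents C" "C \<subseteq> ?W" "?W \<subseteq> span C"
    using associative_subspace_idempotents[of ?W] * by auto
  then show ?thesis using span_superset by blast
qed

text \<open>The summands \<open>a\<close> and \<open>b\<close> lie in the Peirce 1-space of
  \<open>c\<close>, all other members of \<open>C\<close> in its 0-space, and these two spaces
  annihilate each other.\<close>

lemma orthogonal_idempotents_split: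
  fixes C :: "'a::euclidean_jordan_algebra set"
  assumes C: "orthogonal_idempotents C" "c \<in> C" and ab: "c = a + b" "jidempotent a" "jidempotent b" "a \<noteq> 0" "b \<noteq> 0"
  shows "orthogonal_idempotents (insert a (insert b (C - {c})))" (is "orthogonal_idempotents ?D")
    "card (insert a (insert b (C - {c}))) = Suc (card C)" "span C \<subseteq> span (insert a (insert b (C - {c})))"
proof -
  have c: "jidempotent c" using C by (auto simp: orthogonal_idempotents_def)
  have orth: "a \<circ>\<^sub>J b = 0" using jidempotent_sum_orthogonal ab c by blast
  then have ca: "c \<circ>\<^sub>J a = a" "c \<circ>\<^sub>J b = b"
    using ab by (simp_all add: jprod_simps jidempotent_def jprod_commute[of b a])
  have d: "a \<circ>\<^sub>J d = 0 \<and> b \<circ>\<^sub>J d = 0" if "d \<in> C - {c}" for d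
    using that C peirce_one_zero_orthogonal[OF c] ca by (auto simp: orthogonal_idempotents_def)
  then have d': "d \<circ>\<^sub>J a = 0 \<and> d \<circ>\<^sub>J b = 0" if "d \<in> C - {c}" for d
    using that by (metis jprod_commute)
  have orth': "b \<circ>\<^sub>J a = 0" using orth by (simp add: jprod_commute)
  show "orthogonal_idempotents ?D"
    using C(1) ab orth d orth' d' by (auto simp: orthogonal_idempotents_def)
  have "a \<noteq> b" using orth ab by (auto simp: jidempotent_def)
  moreover have "a \<notin> C - {c}" "b \<notin> C - {c}" using d ab by (auto simp: jidempotent_def)
  ultimately show "card ?D = Suc (card C)"
    using orthogonal_idempotents_card(1)[OF C(1)] card_Suc_Diff1[of C c] C(2) by simp
  have "d \<in> span ?D" if "d \<in> C" for d
    using that ab(1) by (cases "d = c") (auto intro: span_add span_base)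
  then show "span C \<subseteq> span ?D" by (meson span_minimal subspace_span subsetI)
qed

text \<open>Powers of \<open>x\<close> provide an orthogonal system whose span contains
  \<open>x\<close> and \<open>junit\<close>. Such a system of maximal size has only primitive
  members, since any other member could be split without shrinking the span.\<close>

theorem spectral_theorem:
  fixes x :: "'a::euclidean_jordan_algebra"
  shows "\<exists>F f. jordan_frame F \<and> x = (\<Sum>c\<in>F. f c *\<^sub>R c)"
proof -
  define P where "P C \<longleftrightarrow> orthogonal_idempotents C \<and> junit \<in> span C \<and> x \<in> span C" for C
  obtain C0 where "orthogonal_idempotents C0" "range (jpower x) \<subseteq> span C0"
    using jpower_span_idempotents[of UNIV x] by auto
  moreover have "junit = jpower x 0" "x = jpower x (Suc 0)"
    by (simp_all add: jpower_0 jpower_Suc jprod_junit_right)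
  ultimately have "P C0" unfolding P_def by (metis rangeI subsetD)
  moreover have "card C < Suc DIM('a)" if "P C" for C
    using that orthogonal_idempotents_card by (auto simp: P_def less_Suc_eq_le)
  ultimately obtain C where C: "P C" and max: "\<And>D. P D \<Longrightarrow> card D \<le> card C"
    using ex_has_greatest_nat[of P C0 card "Suc DIM('a)"] by (metis le_less)
  have oC: "orthogonal_idempotents C" using C by (simp add: P_def)
  have fin: "finite C" using orthogonal_idempotents_card[OF oC] by simp
  have "primitive_idempotent c" if c: "c \<in> C" for c
    unfolding primitive_idempotent_def
  proof (intro conjI notI)
    show "jidempotent c" "c = 0 \<Longrightarrow> False" using oC c by (auto simp: orthogonal_idempotents_def)
    assume "\<exists>a b. jidempotent a \<and> jidempotent b \<and> a \<noteq> 0 \<and> b \<noteq> 0 \<and> c = a + b"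
    then obtain a b where "c = a + b" "jidempotent a" "jidempotent b" "a \<noteq> 0" "b \<noteq> 0" by blast
    from orthogonal_idempotents_split[OF oC c this] C max[of "insert a (insert b (C - {c}))"]
    show False unfolding P_def by auto
  qed
  moreover obtain u where u: "junit = (\<Sum>c\<in>C. u c *\<^sub>R c)"
    using C fin by (auto simp: P_def span_finite)
  \<comment> \<open>Multiplying the expansion of \<open>junit\<close> by a member \<open>c\<close>
    isolates one term, so \<open>u c *\<^sub>R c\<close> is \<open>c\<close>.\<close>
  then have "junit = (\<Sum>c\<in>C. c)"
  proof -
    have "u c *\<^sub>R c = c" if "c \<in> C" for c
      using jprod_orthogonal_sum[OF oC fin order_refl that, of u] that
      by (simp flip: u add: jprod_junit_right)
    then show ?thesis using u by simp
  qed
  ultimately have "jordan_frame C"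
    using fin oC by (auto simp: jordan_frame_def orthogonal_idempotents_def)
  moreover obtain f where "x = (\<Sum>c\<in>C. f c *\<^sub>R c)"
    using C fin by (auto simp: P_def span_finite)
  ultimately show ?thesis by blast
qed

text \<open>The positive powers of \<open>y\<close> stay in the Peirce 1-space of \<open>c\<close>.
  A nonzero idempotent in their span lies below \<open>c\<close> and therefore is \<open>c\<close>;
  as idempotents span these powers, \<open>y\<close> is a multiple of \<open>c\<close>.\<close>

lemma primitive_peirce_one:
  fixes c y :: "'a::euclidean_jordan_algebra"
  assumes c: "primitive_idempotent c" and y: "c \<circ>\<^sub>J y = y"
  obtains t where "y = t *\<^sub>R c"
proof -
  have ci: "jidempotent c" using c by (rule primitive_idempotentD)
  have V: "c \<circ>\<^sub>J jpower y (Suc k) = jpower y (Suc k)" for k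
  proof (induction k)
    case 0 show ?case using y by (simp add: jpower_0 jpower_Suc jprod_junit_right)
  next
    case (Suc k)
    then show ?case
      using peirce_one_commute[OF ci y, of "jpower y (Suc k)"] by (simp add: jpower_Suc)
  qed
  obtain C where C: "orthogonal_idempotents C" "C \<subseteq> span (jpower y ` {1..})" "jpower y ` {1..} \<subseteq> span C"
    using jpower_span_idempotents[of "{1..}" y] by auto
  have "c \<circ>\<^sub>J w = w" if "w \<in> span (jpower y ` {1..})" for w
    using that
  proof (induction w rule: span_induct)
    case base
    show ?case by (auto simp: subspace_def jprod_simps jprod.zero_right)
  next
    case (step w)
    then obtain k where "k \<ge> 1" "w = jpower y k" by auto
    then show ?case using V[of "k - 1"] by simp
  qed
  then have "C \<subseteq> {c}"
    using C primitive_idempotent_below[OF c] unfolding orthogonal_idempotents_def by blast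
  moreover have "y \<in> span C"
  proof -
    have "y = jpower y 1" by (simp add: jpower_0 jpower_Suc jprod_junit_right)
    then show ?thesis using C(3) by (metis atLeast_iff image_eqI order_refl subsetD)
  qed
  ultimately have "y \<in> span {c}" using span_mono by blast
  then show ?thesis using that by (auto simp: span_singleton)
qed

lemma peirce_one_primitive:
  fixes c x :: "'a::euclidean_jordan_algebra"
  assumes c: "primitive_idempotent c"
  shows "peirce_one c x = (inner x c / inner c c) *\<^sub>R c"
proof -
  have ci: "c \<circ>\<^sub>J c = c" "jidempotent c" using primitive_idempotentD[OF c] by (auto simp: jidempotent_def)
  obtain t where t: "peirce_one c x = t *\<^sub>R c"
    using primitive_peirce_one[OF c jprod_peirce_one[OF ci(2)]] by blast
  have "inner (peirce_one c x) c = inner x c"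
    by (simp add: peirce_one_def inner_diff_left inner_jprod[of c _ c] ci)
  then have "t = inner x c / inner c c"
    using t primitive_idempotentD[OF c] by (simp add: field_simps)
  then show ?thesis using t by simp
qed

text \<open>The idea is to compute \<open>\<parallel>c \<circ> d\<parallel>\<^sup>2\<close> once from each idempotent.\<close>

lemma primitive_idempotents_same_norm:
  fixes c d :: "'a::euclidean_jordan_algebra"
  assumes c: "primitive_idempotent c" and d: "primitive_idempotent d" and cd: "inner c d \<noteq> 0"
  shows "inner c c = inner d d"
proof -
  have *: "2 * inner (a \<circ>\<^sub>J b) (a \<circ>\<^sub>J b) = inner a b * (1 + inner a b / inner a a)"
    if a: "primitive_idempotent a" and b: "primitive_idempotent b" for a b :: 'a
  proof -
    have bb: "b \<circ>\<^sub>J b = b" using primitive_idempotentD[OF b] by (simp add: jidempotent_def)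
    have ab: "inner (a \<circ>\<^sub>J b) b = inner a b"
      by (simp add: jprod_commute[of a b] inner_jprod[of b a] bb)
    have "inner (peirce_one a b) b = inner a b * (inner a b / inner a a)"
      by (simp add: peirce_one_primitive[OF a] inner_commute)
    moreover have "inner (peirce_one a b) b = 2 * inner (a \<circ>\<^sub>J b) (a \<circ>\<^sub>J b) - inner a b"
      by (simp add: peirce_one_def inner_diff_left inner_jprod[of a "a \<circ>\<^sub>J b"] ab)
    ultimately show ?thesis by (simp add: algebra_simps)
  qed
  have "inner c d * (1 + inner c d / inner c c) = inner c d * (1 + inner c d / inner d d)"
    using *[OF c d] *[OF d c] by (simp add: jprod_commute inner_commute)
  then show ?thesis
    using cd primitive_idempotentD[OF c] primitive_idempotentD[OF d] by (simp add: field_simps)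
qed

section \<open>Uniqueness of eigenvalues\<close>

lemma frame_list_nth:
  assumes "jordan_frame_list cs" "i < length cs"
  shows "primitive_idempotent (cs ! i)" "jidempotent (cs ! i)" "cs ! i \<noteq> 0" "0 < inner (cs ! i) (cs ! i)"
  using assms primitive_idempotentD[of "cs ! i"]
  by (auto simp: jordan_frame_list_def jordan_frame_def)

lemma frame_list_jprod:
  assumes "jordan_frame_list cs" "i < length cs" "j < length cs"
  shows "cs ! i \<circ>\<^sub>J cs ! j = (if i = j then cs ! i else 0)"
  using assms frame_list_nth(2)[OF assms(1,2)]
  by (auto simp: jordan_frame_list_def jordan_frame_def nth_eq_iff_index_eq jidempotent_def)

lemma frame_list_inner:
  assumes "jordan_frame_list cs" "i < length cs" "j < length cs" "i \<noteq> j"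
  shows "inner (cs ! i) (cs ! j) = 0"
  using frame_list_jprod[OF assms(1-3)] assms(4) inner_junit_jprod[of "cs ! i" "cs ! j"] by simp

lemma sum_set_nth: "distinct cs \<Longrightarrow> sum g (set cs) = (\<Sum>i<length cs. g (cs ! i))"
  by (simp add: sum.distinct_set_conv_list sum_list_sum_nth atLeast0LessThan)

lemma frame_list_sum: "jordan_frame_list cs \<Longrightarrow> (\<Sum>i<length cs. cs ! i) = junit"
  using sum_set_nth[of cs "\<lambda>c. c"] by (simp add: jordan_frame_list_def jordan_frame_def)

lemma frame_list_sum_inner: "jordan_frame_list cs \<Longrightarrow> (\<Sum>i<length cs. inner x (cs ! i)) = inner x junit"
  using frame_list_sum[of cs] by (simp flip: inner_sum_right)

lemma frame_list_length_pos:
  "jordan_frame_list (cs::'a::euclidean_jordan_algebra list) \<Longrightarrow> 0 < length cs"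
  using frame_list_sum[of cs] junit_nonzero[where 'a='a] by (cases cs) auto

lemma spectral_jprod:
  assumes "jordan_frame_list cs" "i < length cs"
  shows "(\<Sum>j<length cs. f j *\<^sub>R (cs ! j)) \<circ>\<^sub>J (cs ! i) = f i *\<^sub>R (cs ! i)"
proof -
  have "(\<Sum>j<length cs. f j *\<^sub>R (cs ! j)) \<circ>\<^sub>J (cs ! i)
      = (\<Sum>j<length cs. if j = i then f i *\<^sub>R (cs ! i) else 0)"
    using assms unfolding jprod.sum_left
    by (intro sum.cong) (auto simp: jprod.scaleR_left frame_list_jprod)
  then show ?thesis using assms by simp
qed

lemma spectral_inner:
  assumes "jordan_frame_list cs" "i < length cs"
  shows "inner (\<Sum>j<length cs. f j *\<^sub>R (cs ! j)) (cs ! i) = f i * inner (cs ! i) (cs ! i)"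
proof -
  have "inner (\<Sum>j<length cs. f j *\<^sub>R (cs ! j)) (cs ! i)
      = (\<Sum>j<length cs. if j = i then f i * inner (cs ! i) (cs ! i) else 0)"
    using assms unfolding inner_sum_left
    by (intro sum.cong) (auto simp: frame_list_inner)
  then show ?thesis using assms by simp
qed

text \<open>Frame members are eigenvectors of the self-adjoint operator L(x), so those with
  different eigenvalues are orthogonal.\<close>

lemma two_frames_inner_eq:
  assumes cs: "jordan_frame_list cs" "i < length cs" and ds: "jordan_frame_list ds" "j < length ds"
    and eq: "(\<Sum>i<length cs. f i *\<^sub>R (cs ! i)) = (\<Sum>j<length ds. g j *\<^sub>R (ds ! j))"
    and ne: "inner (cs ! i) (ds ! j) \<noteq> 0"
  shows "f i = g j"
proof -
  let ?x = "\<Sum>i<length cs. f i *\<^sub>R (cs ! i)"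
  have "f i * inner (cs ! i) (ds ! j) = inner (?x \<circ>\<^sub>J cs ! i) (ds ! j)"
    by (simp add: spectral_jprod[OF cs])
  also have "\<dots> = inner (cs ! i) (?x \<circ>\<^sub>J ds ! j)" by (rule inner_jprod)
  also have "\<dots> = g j * inner (cs ! i) (ds ! j)"
    unfolding eq by (simp add: spectral_jprod[OF ds])
  finally show ?thesis using ne by simp
qed

text \<open>The matrix \<open>\<langle>c\<^sub>i, d\<^sub>j\<rangle> / \<parallel>c\<^sub>i\<parallel>\<^sup>2 = \<langle>c\<^sub>i, d\<^sub>j\<rangle> / \<parallel>d\<^sub>j\<parallel>\<^sup>2\<close> is doubly stochastic, and its nonzero
  entries occur only where the two eigenvalues agree.\<close>

lemma eigenvalue_multiplicity:
  assumes cs: "jordan_frame_list cs" and ds: "jordan_frame_list ds"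
    and eq: "(\<Sum>i<length cs. f i *\<^sub>R (cs ! i)) = (\<Sum>j<length ds. g j *\<^sub>R (ds ! j))"
  shows "card {i. i < length cs \<and> f i = \<mu>} = card {j. j < length ds \<and> g j = \<mu>}"
proof -
  let ?I = "{i. i < length cs \<and> f i = \<mu>}" and ?J = "{j. j < length ds \<and> g j = \<mu>}"
  have *: "(\<Sum>i\<in>{i. i < length as \<and> h i = \<mu>}. \<Sum>j\<in>{j. j < length bs \<and> k j = \<mu>}.
      inner (as ! i) (bs ! j) / inner (as ! i) (as ! i)) = real (card {i. i < length as \<and> h i = \<mu>})"
    if as: "jordan_frame_list as" and bs: "jordan_frame_list bs"
      and e: "(\<Sum>i<length as. h i *\<^sub>R (as ! i)) = (\<Sum>j<length bs. k j *\<^sub>R (bs ! j))"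
    for as bs :: "'a list" and h k
  proof -
    have "(\<Sum>j\<in>{j. j < length bs \<and> k j = \<mu>}. inner (as ! i) (bs ! j) / inner (as ! i) (as ! i)) = 1"
      if i: "i < length as" "h i = \<mu>" for i
    proof -
      have "(\<Sum>j\<in>{j. j < length bs \<and> k j = \<mu>}. inner (as ! i) (bs ! j) / inner (as ! i) (as ! i))
        = (\<Sum>j<length bs. inner (as ! i) (bs ! j) / inner (as ! i) (as ! i))"
        using two_frames_inner_eq[OF as i(1) bs _ e] i(2)
        by (intro sum.mono_neutral_left) auto
      also have "\<dots> = inner (as ! i) junit / inner (as ! i) (as ! i)"
        by (simp add: frame_list_sum_inner[OF bs] flip: sum_divide_distrib)
      finally show ?thesis
        using frame_list_nth[OF as i(1)] by (simp add: idempotent_inner_junit)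
    qed
    then show ?thesis by simp
  qed
  have "real (card ?I) = (\<Sum>i\<in>?I. \<Sum>j\<in>?J. inner (cs ! i) (ds ! j) / inner (cs ! i) (cs ! i))"
    using *[OF cs ds eq] by simp
  also have "\<dots> = (\<Sum>i\<in>?I. \<Sum>j\<in>?J. inner (ds ! j) (cs ! i) / inner (ds ! j) (ds ! j))"
  proof (intro sum.cong refl)
    fix i j assume "i \<in> ?I" "j \<in> ?J"
    then show "inner (cs ! i) (ds ! j) / inner (cs ! i) (cs ! i)
        = inner (ds ! j) (cs ! i) / inner (ds ! j) (ds ! j)"
      using primitive_idempotents_same_norm[of "cs ! i" "ds ! j"] frame_list_nth(1)[OF cs] frame_list_nth(1)[OF ds]
      by (cases "inner (cs ! i) (ds ! j) = 0") (auto simp: inner_commute)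
  qed
  also have "\<dots> = real (card ?J)"
    by (subst sum.swap) (rule *[OF ds cs eq[symmetric]])
  finally show ?thesis by simp
qed

text \<open>\<open>junit\<close> has all coefficients 1 in both frames, so each length is the
  multiplicity of 1.\<close>

lemma frame_list_length_eq:
  assumes "jordan_frame_list (cs::'a::euclidean_jordan_algebra list)" "jordan_frame_list (ds::'a list)"
  shows "length cs = length ds"
  using eigenvalue_multiplicity[OF assms, of "\<lambda>_. 1" "\<lambda>_. 1" 1] assms
  by (simp add: frame_list_sum)

lemma jordan_frame_imp_list: "jordan_frame F \<Longrightarrow> \<exists>cs. set cs = F \<and> jordan_frame_list cs"
  using finite_distinct_list[of F] by (auto simp: jordan_frame_list_def jordan_frame_def)

lemma frame_list_length:
  assumes cs: "jordan_frame_list (cs::'a::euclidean_jordan_algebra list)"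
  shows "length cs = jrank TYPE('a)"
  unfolding jrank_def
proof (rule the_equality[symmetric])
  show "\<exists>E::'a set. jordan_frame E \<and> card E = length cs"
    using cs by (auto simp: jordan_frame_list_def distinct_card intro!: exI[of _ "set cs"])
  fix n assume "\<exists>E::'a set. jordan_frame E \<and> card E = n"
  then obtain ds :: "'a list" where "jordan_frame_list ds" "length ds = n"
    using jordan_frame_imp_list by (metis distinct_card jordan_frame_list_def)
  then show "n = length cs" using frame_list_length_eq[OF cs] by simp
qed

lemma spectral_decomp_exists: "\<exists>as cs. spectral_decomp x as cs"
proof -
  obtain F f where F: "jordan_frame F" "x = (\<Sum>c\<in>F. f c *\<^sub>R c)" using spectral_theorem by blast
  obtain cs where cs: "set cs = F" "jordan_frame_list cs" using jordan_frame_imp_list F by blast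
  have "spectral_decomp x (map f cs) cs"
    using F(2) cs sum_set_nth[of cs "\<lambda>c. f c *\<^sub>R c"]
    by (simp add: spectral_decomp_def jordan_frame_list_def)
  then show ?thesis by blast
qed

lemma spectral_decompD:
  assumes "spectral_decomp x as cs"
  shows "jordan_frame_list cs" "length as = length cs" "x = (\<Sum>i<length cs. (as ! i) *\<^sub>R (cs ! i))"
  using assms by (auto simp: spectral_decomp_def)

lemma spectral_decomp_mset:
  assumes "spectral_decomp x as cs" "spectral_decomp x bs ds"
  shows "mset as = mset bs"
proof (rule multiset_eqI)
  fix \<mu>
  have "count (mset ls) \<mu> = card {i. i < length ls \<and> ls ! i = \<mu>}" for ls :: "real list"
    by (simp add: count_mset count_list_eq_length_filter length_filter_conv_card eq_commute)
  then show "count (mset as) \<mu> = count (mset bs) \<mu>"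
    using eigenvalue_multiplicity[of cs ds "(!) as" "(!) bs" \<mu>] spectral_decompD[OF assms(1)]
      spectral_decompD[OF assms(2)] by simp
qed

lemma spectral_decomp_zip:
  "spectral_decomp x as cs \<longleftrightarrow> jordan_frame_list cs \<and> length as = length cs \<and>
     x = (\<Sum>p\<leftarrow>zip as cs. fst p *\<^sub>R snd p)"
proof -
  have "(\<Sum>p\<leftarrow>zip as cs. fst p *\<^sub>R snd p) = (\<Sum>i<length cs. (as ! i) *\<^sub>R (cs ! i))"
    if "length as = length cs"
    using that by (simp add: sum_list_sum_nth atLeast0LessThan)
  then show ?thesis by (auto simp: spectral_decomp_def)
qed

text \<open>Sorting pairs keeps each coefficient with its idempotent. The key \<open>id\<close>
  gives the eigenvalue vector; the key \<open>abs\<close> gives a decomposition in which the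
  coefficients of |x| decrease.\<close>

lemma spectral_decomp_sorted_by:
  fixes g :: "real \<Rightarrow> real"
  assumes "spectral_decomp x as cs"
  obtains as' cs' where "spectral_decomp x as' cs'" "mset as' = mset as" "sorted_wrt (\<ge>) (map g as')"
proof -
  define ps where "ps = zip as cs"
  define qs where "qs = sort_key (\<lambda>p. - g (fst p)) ps"
  have x: "jordan_frame_list cs" "length as = length cs" "x = (\<Sum>p\<leftarrow>ps. fst p *\<^sub>R snd p)"
    using assms by (auto simp: spectral_decomp_zip ps_def)
  have m: "mset qs = mset ps" by (simp add: qs_def)
  have as: "map fst ps = as" "map snd ps = cs" using x by (simp_all add: ps_def)
  have mf: "mset (map fst qs) = mset as" "mset (map snd qs) = mset cs"
    using m as by (metis mset_map)+
  have "jordan_frame_list (map snd qs)"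
    using x(1) mf(2) mset_eq_setD mset_eq_imp_distinct_iff unfolding jordan_frame_list_def by metis
  moreover have "x = (\<Sum>p\<leftarrow>qs. fst p *\<^sub>R snd p)"
  proof -
    have "mset (map (\<lambda>p. fst p *\<^sub>R snd p) qs) = mset (map (\<lambda>p. fst p *\<^sub>R snd p) ps)"
      using m by simp
    then show ?thesis unfolding x(3) by (metis sum_mset_sum_list)
  qed
  ultimately have "spectral_decomp x (map fst qs) (map snd qs)"
    by (simp add: spectral_decomp_zip zip_map_fst_snd)
  moreover have "sorted_wrt (\<ge>) (map g (map fst qs))"
  proof -
    have "sorted (map (\<lambda>p. - g (fst p)) qs)" by (simp add: qs_def)
    then show ?thesis by (simp add: sorted_wrt_map)
  qed
  ultimately show ?thesis using that mf by blast
qed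

section \<open>Well-definedness of eigenvalue vectors and absolute values\<close>

lemma decreasing_cong: "mset p = mset q \<Longrightarrow> decreasing p = decreasing q"
  using properties_for_sort[of "sort q" p] by (simp add: decreasing_def)

lemma mset_decreasing: "mset (decreasing p) = mset p"
  by (simp add: decreasing_def)

lemma length_decreasing: "length (decreasing p) = length p"
  by (simp add: decreasing_def)

lemma decreasing_sorted: "sorted_wrt (\<ge>) (decreasing p)"
  by (simp add: decreasing_def sorted_wrt_rev)

lemma decreasing_id: "sorted_wrt (\<ge>) p \<Longrightarrow> decreasing p = p"
proof -
  assume "sorted_wrt (\<ge>) p"
  then have "sorted (rev p)" by (simp add: sorted_wrt_rev)
  then have "sort p = rev p" by (metis mset_rev properties_for_sort)
  then show ?thesis by (simp add: decreasing_def)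
qed

lemma eigvals_eq:
  assumes "spectral_decomp x as cs"
  shows "eigvals x = decreasing as"
  unfolding eigvals_def
proof (rule the_equality)
  obtain as' cs' where "spectral_decomp x as' cs'" "mset as' = mset as" "sorted_wrt (\<ge>) (map id as')"
    using spectral_decomp_sorted_by[OF assms] by blast
  moreover from this have "decreasing as = as'" by (metis decreasing_id decreasing_cong list.map_id)
  ultimately show "sorted_wrt (\<ge>) (decreasing as) \<and> (\<exists>cs. spectral_decomp x (decreasing as) cs)" by auto
next
  fix bs assume "sorted_wrt (\<ge>) bs \<and> (\<exists>cs. spectral_decomp x bs cs)"
  then show "bs = decreasing as"
    using spectral_decomp_mset[OF assms] by (metis decreasing_id decreasing_cong)
qed

text \<open>For two spectral decompositions the squared distance of the candidates for |x| is the
  sum of (|a_i| - |b_j|)^2 <c_i, d_j>. Each term vanishes: the idempotents are orthogonal or the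
  coefficients agree.\<close>

lemma jabs_spectral:
  assumes "spectral_decomp x as cs"
  shows "spectral_decomp (jabs x) (map abs as) cs"
proof -
  have "jabs x = (\<Sum>i<length cs. \<bar>as ! i\<bar> *\<^sub>R (cs ! i))"
    unfolding jabs_def
  proof (rule the_equality)
    fix y assume "\<exists>as cs. spectral_decomp x as cs \<and> y = (\<Sum>i<length cs. \<bar>as ! i\<bar> *\<^sub>R (cs ! i))"
    then obtain bs ds where b: "spectral_decomp x bs ds" and y: "y = (\<Sum>i<length ds. \<bar>bs ! i\<bar> *\<^sub>R (ds ! i))"
      by blast
    note c = spectral_decompD[OF assms] and d = spectral_decompD[OF b]
    let ?z = "\<Sum>i<length cs. \<bar>as ! i\<bar> *\<^sub>R (cs ! i)"
    \<comment> \<open>Inserting a second frame, which sums to \<open>junit\<close>, writes a squared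
      norm as a double sum over both frames and so makes the inner products comparable
      termwise.\<close>
    have sq: "inner (\<Sum>i<length es. h i *\<^sub>R (es ! i)) (\<Sum>i<length es. h i *\<^sub>R (es ! i))
        = (\<Sum>i<length es. \<Sum>j<length fs. h i * h i * inner (es ! i) (fs ! j))"
      if es: "jordan_frame_list es" and fs: "jordan_frame_list fs" for es fs :: "'a list" and h
    proof -
      have "inner (\<Sum>i<length es. h i *\<^sub>R (es ! i)) (\<Sum>i<length es. h i *\<^sub>R (es ! i))
          = (\<Sum>i<length es. h i * (h i * inner (es ! i) (es ! i)))"
        unfolding inner_sum_right by (intro sum.cong) (simp_all add: spectral_inner[OF es])
      also have "\<dots> = (\<Sum>i<length es. h i * h i * inner (es ! i) junit)"
        using frame_list_nth[OF es] by (intro sum.cong) (auto simp: idempotent_inner_junit)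
      finally show ?thesis by (simp add: frame_list_sum_inner[OF fs] flip: sum_distrib_left)
    qed
    have 1: "inner ?z ?z = (\<Sum>i<length cs. \<Sum>j<length ds. \<bar>as ! i\<bar> * \<bar>as ! i\<bar> * inner (cs ! i) (ds ! j))"
      by (rule sq[OF c(1) d(1)])
    have 2: "inner y y = (\<Sum>i<length cs. \<Sum>j<length ds. \<bar>bs ! j\<bar> * \<bar>bs ! j\<bar> * inner (cs ! i) (ds ! j))"
      unfolding y sq[OF d(1) c(1)] by (subst sum.swap) (simp add: inner_commute)
    have 3: "inner ?z y = (\<Sum>i<length cs. \<Sum>j<length ds. \<bar>as ! i\<bar> * \<bar>bs ! j\<bar> * inner (cs ! i) (ds ! j))"
      unfolding y by (subst sum.swap) (simp add: inner_sum_left inner_sum_right sum_distrib_left algebra_simps)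
    have "inner (?z - y) (?z - y) = inner ?z ?z + inner y y - 2 * inner ?z y"
      by (simp add: inner_diff_left inner_diff_right inner_commute)
    also have "\<dots> = (\<Sum>i<length cs. \<Sum>j<length ds. (\<bar>as ! i\<bar> - \<bar>bs ! j\<bar>)\<^sup>2 * inner (cs ! i) (ds ! j))"
      unfolding 1 2 3 sum_distrib_left
      by (simp add: power2_eq_square algebra_simps flip: sum.distrib sum_subtractf)
    also have "\<dots> = 0"
      using two_frames_inner_eq[OF c(1) _ d(1), of _ _ "(!) as" "(!) bs"] c(3) d(3)
      by (intro sum.neutral ballI) fastforce
    finally show "y = ?z" by simp
  qed (use assms in blast)
  then show ?thesis using spectral_decompD[OF assms] by (simp add: spectral_decomp_def)
qed

lemma eigvals_jabs: "eigvals (jabs x) = decreasing (map abs (eigvals x))"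
proof -
  obtain as cs where s: "spectral_decomp x as cs" using spectral_decomp_exists by blast
  have "mset (map abs as) = mset (map abs (decreasing as))"
    by (simp add: mset_decreasing)
  then show ?thesis
    using eigvals_eq[OF s] eigvals_eq[OF jabs_spectral[OF s]] decreasing_cong by metis
qed

lemma length_eigvals: "length (eigvals (x::'a::euclidean_jordan_algebra)) = jrank TYPE('a)"
proof -
  obtain as cs where s: "spectral_decomp x as cs" using spectral_decomp_exists by blast
  then show ?thesis
    using spectral_decompD(2)[OF s] frame_list_length[OF spectral_decompD(1)[OF s]]
    by (simp add: eigvals_eq[OF s] length_decreasing)
qed

text \<open>The eigenvalues of \<open>c\<close> are 0 or 1 because \<open>c\<close> is idempotent,
  and a frame member with eigenvalue 1 lies below \<open>c\<close>, hence equals \<open>c\<close>.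
  So 1 occurs exactly once and the trace is 1.\<close>

lemma primitive_inner_self:
  fixes c :: "'a::euclidean_jordan_algebra"
  assumes tr: "\<And>x y :: 'a. inner x y = jtrace (x \<circ>\<^sub>J y)" and c: "primitive_idempotent c"
  shows "inner c c = 1"
proof -
  have ci: "jidempotent c" using c by (rule primitive_idempotentD)
  obtain as cs where s: "spectral_decomp c as cs" using spectral_decomp_exists by blast
  note d = spectral_decompD[OF s]
  have ccs: "c \<circ>\<^sub>J cs ! i = (as ! i) *\<^sub>R (cs ! i)" if "i < length cs" for i
    using spectral_jprod[OF d(1) that, of "(!) as"] d(3) by simp
  have cs0: "cs ! i \<noteq> 0" if "i < length cs" for i using frame_list_nth[OF d(1) that] by simp
  have a01: "as ! i = 0 \<or> as ! i = 1" if i: "i < length cs" for i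
  proof -
    have "(as ! i) *\<^sub>R (cs ! i) = inner (as!i) (as!i) *\<^sub>R (cs ! i)"
    proof -
      have "(\<Sum>i<length cs. (as!i * as!i) *\<^sub>R (cs ! i)) = c \<circ>\<^sub>J (\<Sum>i<length cs. (as!i) *\<^sub>R (cs ! i))"
        unfolding jprod.sum_right by (intro sum.cong) (auto simp: jprod.scaleR_right ccs)
      also have "\<dots> = c" using ci d(3) by (simp add: jidempotent_def)
      finally show ?thesis
        using spectral_jprod[OF d(1) i, of "\<lambda>i. as!i * as!i"] ccs[OF i] by simp
    qed
    then show ?thesis using cs0[OF i] by (auto simp: scaleR_left_imp_eq)
  qed
  obtain i where i: "i < length cs" "as ! i \<noteq> 0"
    using d(3) primitive_idempotentD(2)[OF c] by (metis (no_types, lifting) lessThan_iff scaleR_eq_0_iff sum.neutral)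
  have ai: "as ! i = 1" using a01 i by blast
  have only: "j = i" if j: "j < length cs" "as ! j \<noteq> 0" for j
  proof (rule ccontr)
    assume "j \<noteq> i"
    have aj: "as ! j = 1" using a01 j by blast
    have "cs ! i = c"
      using primitive_idempotent_below[OF c frame_list_nth(2)[OF d(1) i(1)]] ccs[OF i(1)] ai cs0[OF i(1)] by simp
    moreover have "cs ! j = c"
      using primitive_idempotent_below[OF c frame_list_nth(2)[OF d(1) j(1)]] ccs[OF j(1)] aj cs0[OF j(1)] by simp
    ultimately show False using frame_list_jprod[OF d(1) i(1) j(1)] \<open>j \<noteq> i\<close> ci cs0[OF i(1)]
      by (simp add: jidempotent_def)
  qed
  have "as ! j = (if j = i then 1 else 0)" if "j < length cs" for j
    using only[OF that] ai by metis
  then have "sum_list as = (\<Sum>j<length cs. if j = i then 1 else 0)"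
    by (simp add: sum_list_sum_nth atLeast0LessThan d(2))
  then have "sum_list as = 1" using i by simp
  then have "jtrace c = 1"
    using eigvals_eq[OF s] by (metis jtrace_def mset_decreasing sum_mset_sum_list)
  then show ?thesis using tr[of c c] ci by (simp add: jidempotent_def)
qed

section \<open>Peirce decomposition and Schur multipliers\<close>

text \<open>A closed formula for the Peirce components: on V_ij with i < j both multiplications act
  by 1/2, which the factor 4 undoes, and on every other Peirce space one of them is 0.\<close>

definition peirce_part :: "'a::euclidean_jordan_algebra list \<Rightarrow> 'a \<Rightarrow> nat \<Rightarrow> nat \<Rightarrow> 'a" where
  "peirce_part cs x i j =
     (if i = j then peirce_one (cs ! i) x else 4 *\<^sub>R (cs ! i \<circ>\<^sub>J (cs ! j \<circ>\<^sub>J x)))"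

text \<open>An entry function in place of a matrix lets resolvents, powers and limits of multipliers
  be written down directly.\<close>

definition schur_multiplier ::
    "'a::euclidean_jordan_algebra list \<Rightarrow> (nat \<Rightarrow> nat \<Rightarrow> real) \<Rightarrow> 'a \<Rightarrow> 'a" where
  "schur_multiplier cs B x = (\<Sum>j<length cs. \<Sum>i\<le>j. B i j *\<^sub>R peirce_part cs x i j)"

text \<open>The numbers <c_l y, y> are nonnegative and sum to |y|^2. If \<open>i\<close> and
  \<open>j\<close> differ, these two indices already contribute |y|^2, so all others give 0, and a
  vanishing form forces c_k y = 0.\<close>

lemma peirce_space_jprod:
  assumes cs: "jordan_frame_list cs" and i: "i < length cs" and j: "j < length cs" and k: "k < length cs"
    and y: "y \<in> peirce_space cs i j"
  shows "cs ! k \<circ>\<^sub>J y = ((of_bool (k = i) + of_bool (k = j)) / 2) *\<^sub>R y"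
proof (cases "i = j")
  case True
  then obtain t where "y = t *\<^sub>R (cs ! i)" using y by (auto simp: peirce_space_def)
  then show ?thesis using True frame_list_jprod[OF cs k i] by (simp add: jprod.scaleR_right)
next
  case False
  have half: "cs ! i \<circ>\<^sub>J y = (1/2) *\<^sub>R y" "cs ! j \<circ>\<^sub>J y = (1/2) *\<^sub>R y"
    using y False by (auto simp: peirce_space_def jprod_commute)
  show ?thesis
  proof (cases "k = i \<or> k = j")
    case True then show ?thesis using half False by auto
  next
    case k': False
    let ?f = "\<lambda>l. inner (cs ! l \<circ>\<^sub>J y) y"
    have "(\<Sum>l<length cs. ?f l) = inner (junit \<circ>\<^sub>J y) y"
      by (simp flip: frame_list_sum[OF cs] add: jprod.sum_left inner_sum_left)
    moreover have "sum ?f {i, j, k} \<le> sum ?f {..<length cs}"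
      using i j k idempotent_nonneg_form frame_list_nth(2)[OF cs] by (intro sum_mono2) auto
    moreover have "sum ?f {i, j, k} = inner y y + ?f k"
      using False k' by (simp add: half)
    ultimately have "?f k \<le> 0" by (simp add: jprod_junit)
    then have "?f k = 0" using idempotent_nonneg_form[OF frame_list_nth(2)[OF cs k], of y] by simp
    then show ?thesis using idempotent_form_eq_0[OF frame_list_nth(2)[OF cs k]] k' by simp
  qed
qed

lemma linear_peirce_part: "linear (\<lambda>x. peirce_part cs x i j)"
  by (intro linearI)
    (simp_all add: peirce_part_def peirce_one_def jprod_simps scaleR_add_right scaleR_diff_right algebra_simps)

lemma peirce_part_of_peirce_space:
  assumes cs: "jordan_frame_list cs" and l: "k \<le> l" "l < length cs" and j: "i \<le> j" "j < length cs"
    and y: "y \<in> peirce_space cs k l"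
  shows "peirce_part cs y i j = (if i = k \<and> j = l then y else 0)"
proof -
  have *: "cs ! m \<circ>\<^sub>J y = ((of_bool (m = k) + of_bool (m = l)) / 2) *\<^sub>R y" if "m < length cs" for m
    using peirce_space_jprod[OF cs _ l(2) that y] l by simp
  show ?thesis
    using l j *[of i] *[of j]
    by (auto simp: peirce_part_def peirce_one_def jprod.scaleR_right scaleR_2 split: if_splits)
qed

lemma peirce_part_in_space:
  assumes cs: "jordan_frame_list cs" and i: "i < length cs" and j: "j < length cs"
  shows "peirce_part cs x i j \<in> peirce_space cs i j"
proof (cases "i = j")
  case True
  then show ?thesis
    by (auto simp: peirce_part_def peirce_space_def peirce_one_primitive[OF frame_list_nth(1)[OF cs j]])
next
  case False
  \<comment> \<open>The 1-projection of c_k commutes with L(c_l) and maps into the line of c_k,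
    which L(c_l) kills. So it vanishes on c_l x, that is, 2 L(c_k)^2 = L(c_k) there.\<close>
  have *: "cs ! k \<circ>\<^sub>J (cs ! k \<circ>\<^sub>J (cs ! l \<circ>\<^sub>J x)) = (1/2) *\<^sub>R (cs ! k \<circ>\<^sub>J (cs ! l \<circ>\<^sub>J x))"
    if "k < length cs" "l < length cs" "k \<noteq> l" for k l
  proof -
    have lk: "cs ! l \<circ>\<^sub>J cs ! k = 0" "cs ! k \<circ>\<^sub>J cs ! l = 0"
      using frame_list_jprod[OF cs that(2,1)] frame_list_jprod[OF cs that(1,2)] that by auto
    have comm: "cs ! k \<circ>\<^sub>J (cs ! l \<circ>\<^sub>J y) = cs ! l \<circ>\<^sub>J (cs ! k \<circ>\<^sub>J y)" for y
      by (rule idempotent_orthogonal_jprod[OF frame_list_nth(2)[OF cs that(1)] lk(2)])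
    have "peirce_one (cs ! k) (cs ! l \<circ>\<^sub>J x) = cs ! l \<circ>\<^sub>J peirce_one (cs ! k) x"
      by (simp add: peirce_one_def comm jprod_simps)
    also have "\<dots> = 0"
      by (simp add: peirce_one_primitive[OF frame_list_nth(1)[OF cs that(1)]] jprod.scaleR_right lk)
    finally show ?thesis
      using arg_cong[of "2 *\<^sub>R (cs ! k \<circ>\<^sub>J (cs ! k \<circ>\<^sub>J (cs ! l \<circ>\<^sub>J x)))" _ "\<lambda>v. (1/2) *\<^sub>R v"]
      by (simp add: peirce_one_def)
  qed
  have comm: "cs ! i \<circ>\<^sub>J (cs ! j \<circ>\<^sub>J x) = cs ! j \<circ>\<^sub>J (cs ! i \<circ>\<^sub>J x)"
    using frame_list_jprod[OF cs i j] False
    by (intro idempotent_orthogonal_jprod[OF frame_list_nth(2)[OF cs i]]) simp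
  have "cs ! i \<circ>\<^sub>J peirce_part cs x i j = (1/2) *\<^sub>R peirce_part cs x i j"
    using *[OF i j] False by (simp add: peirce_part_def jprod.scaleR_right)
  moreover have "cs ! j \<circ>\<^sub>J peirce_part cs x i j = (1/2) *\<^sub>R peirce_part cs x i j"
    using *[OF j i] False by (simp add: peirce_part_def jprod.scaleR_right comm)
  ultimately show ?thesis using False by (simp add: peirce_space_def jprod_commute)
qed

lemma sum_symmetric:
  fixes h :: "nat \<Rightarrow> nat \<Rightarrow> 'b::real_vector"
  assumes "\<And>i j. i < n \<Longrightarrow> j < n \<Longrightarrow> h i j = h j i"
  shows "(\<Sum>i<n. \<Sum>j<n. h i j) = (\<Sum>j<n. h j j + 2 *\<^sub>R (\<Sum>i<j. h i j))"
  using assms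
proof (induction n)
  case (Suc n)
  have "(\<Sum>j<n. h n j) = (\<Sum>i<n. h i n)" using Suc.prems by (intro sum.cong) auto
  then show ?case using Suc by (simp add: sum.distrib scaleR_2)
qed simp

text \<open>Expanding x = e (e x) in the frame gives the symmetric double sum of c_i (c_j x). The
  factors 4 off the diagonal and 2 on it produce 2x, and the terms -c_j x sum to -x.\<close>

lemma peirce_part_sum:
  assumes cs: "jordan_frame_list cs"
  shows "(\<Sum>j<length cs. \<Sum>i\<le>j. peirce_part cs x i j) = x"
proof -
  let ?h = "\<lambda>i j. cs ! i \<circ>\<^sub>J (cs ! j \<circ>\<^sub>J x)"
  have one: "(\<Sum>i<length cs. cs ! i \<circ>\<^sub>J y) = y" for y
    by (simp add: frame_list_sum[OF cs] jprod_junit flip: jprod.sum_left)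
  have "(\<Sum>i<length cs. \<Sum>j<length cs. ?h i j) = x"
    by (simp add: one flip: jprod.sum_right)
  moreover have "?h i j = ?h j i" if "i < length cs" "j < length cs" for i j
    using idempotent_orthogonal_jprod[OF frame_list_nth(2)[OF cs that(1)], of "cs ! j"]
      frame_list_jprod[OF cs that] by (cases "i = j") auto
  ultimately have sym: "(\<Sum>j<length cs. ?h j j + 2 *\<^sub>R (\<Sum>i<j. ?h i j)) = x"
    using sum_symmetric[of "length cs" ?h] by simp
  have "(\<Sum>i\<le>j. peirce_part cs x i j) = 2 *\<^sub>R (?h j j + 2 *\<^sub>R (\<Sum>i<j. ?h i j)) - cs ! j \<circ>\<^sub>J x" for j
    by (simp add: atMost_nat_numeral lessThan_Suc_atMost[symmetric] peirce_part_def peirce_one_def scaleR_sum_right scaleR_add_right)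
  then have "(\<Sum>j<length cs. \<Sum>i\<le>j. peirce_part cs x i j)
      = 2 *\<^sub>R (\<Sum>j<length cs. ?h j j + 2 *\<^sub>R (\<Sum>i<j. ?h i j)) - (\<Sum>j<length cs. cs ! j \<circ>\<^sub>J x)"
    by (simp add: sum_subtractf scaleR_sum_right)
  then show ?thesis using sym one by (simp add: scaleR_2)
qed

lemma peirce_part_of_decomposition:
  assumes cs: "jordan_frame_list cs" and j: "i \<le> j" "j < length cs"
    and X: "\<And>k l. k \<le> l \<Longrightarrow> l < length cs \<Longrightarrow> X k l \<in> peirce_space cs k l"
  shows "peirce_part cs (\<Sum>l<length cs. \<Sum>k\<le>l. X k l) i j = X i j"
proof -
  have "peirce_part cs (\<Sum>l<length cs. \<Sum>k\<le>l. X k l) i j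
      = (\<Sum>l<length cs. \<Sum>k\<le>l. peirce_part cs (X k l) i j)"
    by (simp add: linear_sum[OF linear_peirce_part])
  also have "\<dots> = (\<Sum>l<length cs. \<Sum>k\<le>l. if k = i then if l = j then X i j else 0 else 0)"
    using peirce_part_of_peirce_space[OF cs _ _ j X] by (intro sum.cong) auto
  also have "\<dots> = (\<Sum>l<length cs. if l = j then X i j else 0)"
    using j by (intro sum.cong) auto
  finally show ?thesis using j by simp
qed

text \<open>Uniqueness holds because \<open>peirce_part\<close> recovers the terms of any Peirce
  decomposition.\<close>

lemma peirce_component_eq:
  assumes cs: "jordan_frame_list cs" and j: "i \<le> j" "j < length cs"
  shows "peirce_component cs x i j = peirce_part cs x i j"
  unfolding peirce_component_def
proof (rule the_equality)
  have "peirce_decomp cs x (peirce_part cs x)"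
    using peirce_part_in_space[OF cs] peirce_part_sum[OF cs] by (auto simp: peirce_decomp_def)
  then show "\<exists>X. peirce_decomp cs x X \<and> peirce_part cs x i j = X i j" by blast
  fix y assume "\<exists>X. peirce_decomp cs x X \<and> y = X i j"
  then show "y = peirce_part cs x i j"
    using peirce_part_of_decomposition[OF cs j] by (auto simp: peirce_decomp_def)
qed

lemma schur_product_eq:
  "jordan_frame_list cs \<Longrightarrow> schur_product cs A x = schur_multiplier cs (\<lambda>i j. A $$ (i, j)) x"
  unfolding schur_product_def schur_multiplier_def
  by (intro sum.cong) (auto simp: peirce_component_eq)

section \<open>The algebra of Schur multipliers\<close>

lemma linear_schur_multiplier: "linear (schur_multiplier cs B)"
  unfolding schur_multiplier_def
  by (intro linear_compose_sum ballI linear_compose_scale_right linear_peirce_part)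

lemma schur_multiplier_cong:
  assumes "\<And>i j. i < length cs \<Longrightarrow> j < length cs \<Longrightarrow> B i j = C i j"
  shows "schur_multiplier cs B x = schur_multiplier cs C x"
  unfolding schur_multiplier_def using assms by (intro sum.cong) auto

lemma peirce_part_schur_multiplier:
  assumes cs: "jordan_frame_list cs" and j: "i \<le> j" "j < length cs"
  shows "peirce_part cs (schur_multiplier cs B x) i j = B i j *\<^sub>R peirce_part cs x i j"
proof -
  have "t *\<^sub>R peirce_part cs x k l \<in> peirce_space cs k l" if "k \<le> l" "l < length cs" for k l t
    using peirce_part_in_space[OF cs _ that(2), of k x] that
    by (auto simp: peirce_space_def jprod.scaleR_left image_iff)
  then show ?thesis unfolding schur_multiplier_def by (intro peirce_part_of_decomposition[OF cs j])
qed

lemma schur_multiplier_mult: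
  assumes cs: "jordan_frame_list cs"
  shows "schur_multiplier cs B (schur_multiplier cs C x) = schur_multiplier cs (\<lambda>i j. B i j * C i j) x"
  unfolding schur_multiplier_def[of cs B] schur_multiplier_def[of cs "\<lambda>i j. B i j * C i j"]
  by (intro sum.cong) (auto simp: peirce_part_schur_multiplier[OF cs])

lemma schur_multiplier_one: "jordan_frame_list cs \<Longrightarrow> schur_multiplier cs (\<lambda>_ _. 1) x = x"
  by (simp add: schur_multiplier_def peirce_part_sum)

lemma schur_multiplier_lincomb:
  "schur_multiplier cs (\<lambda>i j. s * B i j + t * C i j) x
    = s *\<^sub>R schur_multiplier cs B x + t *\<^sub>R schur_multiplier cs C x"
  by (simp add: schur_multiplier_def scaleR_sum_right scaleR_add_left flip: sum.distrib)

lemma schur_multiplier_sum: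
  "schur_multiplier cs (\<lambda>i j. \<Sum>k\<in>K. B k i j) x = (\<Sum>k\<in>K. schur_multiplier cs (B k) x)"
  unfolding schur_multiplier_def scaleR_sum_left
  by (subst sum.swap[of _ _ K], intro sum.cong refl, rule sum.swap)

text \<open>On V_ij only c_i and c_j act, by 1/2 each (together by 1 if i = j), so L(z) is a
  multiplier, and functions of L(z) can be formed entrywise.\<close>

lemma schur_multiplier_jprod:
  assumes cs: "jordan_frame_list cs"
  shows "schur_multiplier cs (\<lambda>i j. (z i + z j) / 2) x = (\<Sum>k<length cs. z k *\<^sub>R (cs ! k)) \<circ>\<^sub>J x"
proof -
  let ?z = "\<Sum>k<length cs. z k *\<^sub>R (cs ! k)"
  have *: "?z \<circ>\<^sub>J peirce_part cs x i j = ((z i + z j) / 2) *\<^sub>R peirce_part cs x i j"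
    if "i \<le> j" "j < length cs" for i j
  proof -
    have i: "i < length cs" using that by simp
    have "?z \<circ>\<^sub>J peirce_part cs x i j
        = (\<Sum>k<length cs. z k * ((of_bool (k = i) + of_bool (k = j)) / 2)) *\<^sub>R peirce_part cs x i j"
      unfolding jprod.sum_left scaleR_sum_left
      using peirce_space_jprod[OF cs i that(2) _ peirce_part_in_space[OF cs i that(2)]]
      by (intro sum.cong) (auto simp: jprod.scaleR_left)
    also have "(\<Sum>k<length cs. z k * ((of_bool (k = i) + of_bool (k = j)) / 2)) = (z i + z j) / 2"
    proof -
      have "(\<Sum>k<length cs. z k * ((of_bool (k = i) + of_bool (k = j)) / 2))
        = (\<Sum>k<length cs. (if k = i then z i / 2 else 0) + (if k = j then z j / 2 else 0))"
        by (intro sum.cong) (auto simp: field_simps)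
      then show ?thesis using i that(2) by (simp add: sum.distrib add_divide_distrib)
    qed
    finally show ?thesis .
  qed
  have "?z \<circ>\<^sub>J x = ?z \<circ>\<^sub>J (\<Sum>j<length cs. \<Sum>i\<le>j. peirce_part cs x i j)"
    by (simp add: peirce_part_sum[OF cs])
  also have "\<dots> = (\<Sum>j<length cs. \<Sum>i\<le>j. ?z \<circ>\<^sub>J peirce_part cs x i j)"
    by (simp add: jprod.sum_right)
  also have "\<dots> = schur_multiplier cs (\<lambda>i j. (z i + z j) / 2) x"
    unfolding schur_multiplier_def using * by (intro sum.cong) auto
  finally show ?thesis by simp
qed

lemma schur_multiplier_diagonal:
  assumes cs: "jordan_frame_list cs"
  shows "schur_multiplier cs B (\<Sum>k<length cs. z k *\<^sub>R (cs ! k)) = (\<Sum>k<length cs. (B k k * z k) *\<^sub>R (cs ! k))"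
proof -
  have "schur_multiplier cs B (cs ! k) = B k k *\<^sub>R (cs ! k)" if k: "k < length cs" for k
  proof -
    have "cs ! k \<in> peirce_space cs k k" by (auto simp: peirce_space_def intro: range_eqI[of _ _ 1])
    then have "schur_multiplier cs B (cs ! k)
        = (\<Sum>j<length cs. \<Sum>i\<le>j. if i = k then if j = k then B k k *\<^sub>R (cs ! k) else 0 else 0)"
      unfolding schur_multiplier_def using peirce_part_of_peirce_space[OF cs order_refl k]
      by (intro sum.cong) auto
    also have "\<dots> = (\<Sum>j<length cs. if j = k then B k k *\<^sub>R (cs ! k) else 0)"
      by (intro sum.cong) auto
    finally show ?thesis using k by simp
  qed
  then show ?thesis
    by (simp add: linear_sum[OF linear_schur_multiplier] linear_scale[OF linear_schur_multiplier] mult.commute)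
qed

lemma schur_multiplier_self_adjoint:
  assumes cs: "jordan_frame_list cs"
  shows "inner (schur_multiplier cs B x) y = inner x (schur_multiplier cs B y)"
proof -
  have "inner (peirce_part cs x i j) y = inner x (peirce_part cs y i j)" if "i \<le> j" "j < length cs" for i j
  proof -
    have i: "i < length cs" using that by simp
    have "cs ! i \<circ>\<^sub>J (cs ! j \<circ>\<^sub>J y) = cs ! j \<circ>\<^sub>J (cs ! i \<circ>\<^sub>J y)" if "i \<noteq> j"
      using frame_list_jprod[OF cs i \<open>j < length cs\<close>] that
      by (intro idempotent_orthogonal_jprod[OF frame_list_nth(2)[OF cs i]]) simp
    then show ?thesis
      by (simp add: peirce_part_def peirce_one_def inner_diff_left inner_diff_right inner_jprod[of "cs ! _"])
  qed
  then show ?thesis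
    unfolding schur_multiplier_def inner_sum_left inner_sum_right
    by (intro sum.cong) auto
qed

section \<open>Positivity of Schur multipliers\<close>

text \<open>This test describes the elements with nonnegative eigenvalues, and it makes closure
  under sums and limits immediate.\<close>

definition jpositive :: "'a::euclidean_jordan_algebra \<Rightarrow> bool" where
  "jpositive x \<longleftrightarrow> (\<forall>f. primitive_idempotent f \<longrightarrow> 0 \<le> inner x f)"

lemma jpositive_sum_idempotents:
  assumes "\<And>i. i \<in> I \<Longrightarrow> 0 \<le> a i" "\<And>i. i \<in> I \<Longrightarrow> jidempotent (c i)"
  shows "jpositive (\<Sum>i\<in>I. a i *\<^sub>R c i)"
  using assms
  by (auto simp: jpositive_def inner_sum_left primitive_idempotentD intro!: sum_nonneg mult_nonneg_nonneg idempotent_inner_nonneg)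

lemma jpositive_idempotent: "jidempotent c \<Longrightarrow> jpositive c"
  by (simp add: jpositive_def idempotent_inner_nonneg primitive_idempotentD)

text \<open>Members of a spectral frame are primitive, so the test makes the eigenvalues of
  \<open>x\<close> nonnegative; other idempotents follow termwise.\<close>

lemma jpositive_inner_idempotent:
  assumes x: "jpositive x" and d: "jidempotent d"
  shows "0 \<le> inner x d"
proof -
  obtain as cs where s: "spectral_decomp x as cs" using spectral_decomp_exists by blast
  note D = spectral_decompD[OF s]
  have "0 \<le> as ! i" if i: "i < length cs" for i
  proof -
    have "0 \<le> inner x (cs ! i)" using x frame_list_nth[OF D(1) i] by (simp add: jpositive_def)
    also have "inner x (cs ! i) = as ! i * inner (cs ! i) (cs ! i)"
      using spectral_inner[OF D(1) i, of "(!) as"] D(3) by simp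
    finally show ?thesis using frame_list_nth(4)[OF D(1) i] by (simp add: zero_le_mult_iff)
  qed
  then show ?thesis
    using frame_list_nth(2)[OF D(1)] idempotent_inner_nonneg[OF _ d]
    by (subst D(3)) (auto simp: inner_sum_left intro!: sum_nonneg mult_nonneg_nonneg)
qed

text \<open>The multiplier inverts \<open>I - L(z)\<close> for \<open>z = \<Sum> z\<^sub>k c\<^sub>k\<close>. If \<open>u = x - z \<circ> x\<close> is positive and \<open>f\<close> is a spectral
  idempotent of \<open>x\<close> with eigenvalue \<open>a\<close>, then \<open>\<langle>u, f\<rangle> = a (\<parallel>f\<parallel>\<^sup>2 - \<langle>z, f\<rangle>)\<close>, so \<open>a \<ge> 0\<close>.\<close>

lemma jpositive_resolvent:
  assumes cs: "jordan_frame_list cs" and z: "\<And>i. i < length cs \<Longrightarrow> z i \<le> 1/2" and u: "jpositive u"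
  shows "jpositive (schur_multiplier cs (\<lambda>i j. 1 / (1 - (z i + z j) / 2)) u)"
proof -
  define x where "x = schur_multiplier cs (\<lambda>i j. 1 / (1 - (z i + z j) / 2)) u"
  define Z where "Z = (\<Sum>k<length cs. z k *\<^sub>R (cs ! k))"
  have "schur_multiplier cs (\<lambda>i j. 1 * 1 + (-1) * ((z i + z j) / 2)) x = u"
  proof -
    have inv: "(1 * 1 + (-1) * q) * (1 / (1 - q)) = 1" if "q \<le> 1/2" for q :: real
      using that by simp
    have "(z i + z j) / 2 \<le> 1/2" if "i < length cs" "j < length cs" for i j
      using z[OF that(1)] z[OF that(2)] by simp
    then have "schur_multiplier cs (\<lambda>i j. 1 * 1 + (-1) * ((z i + z j) / 2)) x = schur_multiplier cs (\<lambda>_ _. 1) u"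
      unfolding x_def schur_multiplier_mult[OF cs] by (intro schur_multiplier_cong inv)
    then show ?thesis by (simp add: schur_multiplier_one[OF cs])
  qed
  then have ux: "u = x - Z \<circ>\<^sub>J x"
    unfolding schur_multiplier_lincomb schur_multiplier_one[OF cs] schur_multiplier_jprod[OF cs]
    by (simp add: Z_def)
  obtain as fs where s: "spectral_decomp x as fs" using spectral_decomp_exists by blast
  note D = spectral_decompD[OF s]
  have "0 \<le> as ! i" if i: "i < length fs" for i
  proof -
    let ?f = "fs ! i"
    note f = frame_list_nth[OF D(1) i]
    have xf: "x \<circ>\<^sub>J ?f = as ! i *\<^sub>R ?f" "inner x ?f = as ! i * inner ?f ?f"
      using spectral_jprod[OF D(1) i, of "(!) as"] spectral_inner[OF D(1) i, of "(!) as"] D(3) by simp_all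
    \<comment> \<open>The bound 1/2 on z gives <Z, f> at most <e, f>/2 = |f|^2/2, so the factor of
      the eigenvalue is positive.\<close>
    have "inner Z ?f \<le> (\<Sum>k<length cs. (1/2) * inner (cs ! k) ?f)"
      unfolding Z_def inner_sum_left inner_scaleR_left
      using z idempotent_inner_nonneg[OF frame_list_nth(2)[OF cs] f(2)]
      by (intro sum_mono mult_right_mono) auto
    also have "\<dots> = (1/2) * inner ?f ?f"
    proof -
      have "(\<Sum>k<length cs. inner (cs ! k) ?f) = inner ?f ?f"
        using frame_list_sum_inner[OF cs, of ?f] idempotent_inner_junit[OF f(2)] by (simp add: inner_commute)
      then show ?thesis by (simp only: sum_distrib_left[symmetric])
    qed
    finally have pos: "0 < inner ?f ?f - inner Z ?f" using f(4) by linarith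
    have "0 \<le> inner u ?f" using u f by (simp add: jpositive_def)
    also have "inner u ?f = as ! i * (inner ?f ?f - inner Z ?f)"
      unfolding ux
      by (simp add: inner_diff_left jprod_commute[of Z x] inner_jprod[of x Z] xf algebra_simps)
    finally show ?thesis using pos by (simp add: zero_le_mult_iff)
  qed
  then have "jpositive (\<Sum>i<length fs. as ! i *\<^sub>R fs ! i)"
    using frame_list_nth(2)[OF D(1)] by (intro jpositive_sum_idempotents) auto
  then show ?thesis using D(3) x_def by simp
qed

lemma jpositive_multiplier_power:
  assumes cs: "jordan_frame_list cs" and B: "\<And>u. jpositive u \<Longrightarrow> jpositive (schur_multiplier cs B u)"
    and u: "jpositive u"
  shows "jpositive (schur_multiplier cs (\<lambda>i j. B i j ^ m) u)"
proof (induction m)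
  case 0 show ?case using u by (simp add: schur_multiplier_one[OF cs])
next
  case (Suc m)
  from B[OF this] show ?case by (simp add: schur_multiplier_mult[OF cs])
qed

lemma jpositive_multiplier_limit:
  fixes B :: "nat \<Rightarrow> nat \<Rightarrow> nat \<Rightarrow> real"
  assumes pos: "eventually (\<lambda>m. jpositive (schur_multiplier cs (B m) u)) sequentially"
    and lim: "\<And>i j. i < length cs \<Longrightarrow> j < length cs \<Longrightarrow> (\<lambda>m. B m i j) \<longlonglongrightarrow> C i j"
  shows "jpositive (schur_multiplier cs C u)"
  unfolding jpositive_def
proof (intro allI impI)
  fix f :: 'a assume f: "primitive_idempotent f"
  have "(\<lambda>m. inner (schur_multiplier cs (B m) u) f) \<longlonglongrightarrow> inner (schur_multiplier cs C u) f"
    unfolding schur_multiplier_def using lim by (intro tendsto_intros) auto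
  moreover have "eventually (\<lambda>m. 0 \<le> inner (schur_multiplier cs (B m) u) f) sequentially"
    using pos by eventually_elim (use f in \<open>simp add: jpositive_def\<close>)
  ultimately show "0 \<le> inner (schur_multiplier cs C u) f"
    by (rule tendsto_lowerbound) simp
qed

text \<open>The m-th power of the resolvent at z/m has the entries (1 - q/m)^(-m) with q = (z_i +
  z_j)/2, which tend to exp q.\<close>

lemma jpositive_exp_multiplier:
  assumes cs: "jordan_frame_list cs" and u: "jpositive u"
  shows "jpositive (schur_multiplier cs (\<lambda>i j. exp ((z i + z j) / 2)) u)"
proof (rule jpositive_multiplier_limit)
  let ?B = "\<lambda>(m::nat) i j. (1 / (1 - (z i / real m + z j / real m) / 2)) ^ m"
  \<comment> \<open>From \<open>N\<close> on, every z_i/m is at most 1/2, as the resolvent lemma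
    requires.\<close>
  obtain N :: nat where N: "2 * (\<Sum>i<length cs. \<bar>z i\<bar>) + 1 < real N" using reals_Archimedean2 by blast
  show "eventually (\<lambda>m. jpositive (schur_multiplier cs (?B m) u)) sequentially"
    using eventually_ge_at_top[of N]
  proof eventually_elim
    fix m assume m: "N \<le> m"
    have "z i / real m \<le> 1/2" if "i < length cs" for i
    proof -
      have "z i \<le> (\<Sum>i<length cs. \<bar>z i\<bar>)"
        using member_le_sum[of i "{..<length cs}" "\<lambda>i. \<bar>z i\<bar>"] that by simp
      moreover have "0 \<le> (\<Sum>i<length cs. \<bar>z i\<bar>)" by (simp add: sum_nonneg)
      ultimately have "2 * z i \<le> real m" "0 < real m" using N m by linarith+
      then show ?thesis by (simp add: divide_le_eq)
    qed
    from jpositive_multiplier_power[OF cs jpositive_resolvent[OF cs this] u]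
    show "jpositive (schur_multiplier cs (?B m) u)" by simp
  qed
  fix i j
  have "(\<lambda>m. inverse ((1 + (- ((z i + z j) / 2)) / real m) ^ m)) \<longlonglongrightarrow> inverse (exp (- ((z i + z j) / 2)))"
    by (intro tendsto_inverse tendsto_exp_limit_sequentially) simp
  moreover have "?B m i j = inverse ((1 + (- ((z i + z j) / 2)) / real m) ^ m)" for m
  proof -
    have "1 - (z i / real m + z j / real m) / 2 = 1 + (- ((z i + z j) / 2)) / real m"
      by (cases "m = 0") (simp_all add: field_simps)
    then show ?thesis by (simp only: power_one_over inverse_eq_divide)
  qed
  ultimately show "(\<lambda>m. ?B m i j) \<longlonglongrightarrow> exp ((z i + z j) / 2)" by (simp add: exp_minus)
qed

text \<open>With z = 2 ln w the exponential multiplier has the entries w_i w_j. Zeros of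
  \<open>v\<close> admit no logarithm, hence the shift by 1/(m+1) and a limit.\<close>

lemma jpositive_rank_one_nonneg:
  assumes cs: "jordan_frame_list cs" and u: "jpositive u" and v: "\<And>i. 0 \<le> v i"
  shows "jpositive (schur_multiplier cs (\<lambda>i j. v i * v j) u)"
proof (rule jpositive_multiplier_limit)
  let ?B = "\<lambda>(m::nat) i j. (v i + 1 / real (Suc m)) * (v j + 1 / real (Suc m))"
  show "eventually (\<lambda>m. jpositive (schur_multiplier cs (?B m) u)) sequentially"
  proof (rule always_eventually, rule allI)
    fix m
    let ?w = "\<lambda>i. v i + 1 / real (Suc m)"
    have "0 < ?w i" for i using v[of i] by (intro add_nonneg_pos) auto
    moreover have "exp ((2 * ln a + 2 * ln b) / 2) = a * b" if "0 < a" "0 < b" for a b :: real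
      using that by (simp add: add_divide_distrib exp_add)
    ultimately have "exp ((2 * ln (?w i) + 2 * ln (?w j)) / 2) = ?B m i j" for i j by blast
    then show "jpositive (schur_multiplier cs (?B m) u)"
      using jpositive_exp_multiplier[OF cs u, of "\<lambda>i. 2 * ln (?w i)"] by simp
  qed
  fix i j
  have "(\<lambda>m. ?B m i j) \<longlonglongrightarrow> (v i + 0) * (v j + 0)"
    by (intro tendsto_intros LIMSEQ_Suc[OF lim_1_over_n])
  then show "(\<lambda>m. ?B m i j) \<longlonglongrightarrow> v i * v j" by simp
qed

text \<open>For an idempotent this is the quadratic representation of e - 2c: it is -1 on the Peirce
  1/2-space and the identity on the other two.\<close>

definition peirce_reflection :: "'a::euclidean_jordan_algebra \<Rightarrow> 'a \<Rightarrow> 'a" where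
  "peirce_reflection c x = x - 2 *\<^sub>R peirce_half c x"

text \<open>The polarized identity at x = w and y = z = c collapses to this equation: the square of
  an element of the 1/2-space has no 1/2-component.\<close>

lemma peirce_half_square:
  fixes c w :: "'a::euclidean_jordan_algebra"
  assumes c: "jidempotent c" and w: "c \<circ>\<^sub>J w = (1/2) *\<^sub>R w"
  shows "c \<circ>\<^sub>J (c \<circ>\<^sub>J (w \<circ>\<^sub>J w)) = c \<circ>\<^sub>J (w \<circ>\<^sub>J w)"
  using jordan_identity_polarized[of w c c] c w
  by (simp add: jidempotent_def jprod_commute[of w c] jprod_commute[of "w \<circ>\<^sub>J w" c] jprod_commute[of w "c \<circ>\<^sub>J _"]
      jprod_commute[of "(1/2) *\<^sub>R w" c] jprod.scaleR_left jprod.scaleR_right)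

text \<open>Write x = p + u with \<open>u\<close> the 1/2-component. Then p p and u u have no
  1/2-component and p u lies in the 1/2-space, so changing the sign of \<open>u\<close> respects
  squares.\<close>

lemma peirce_reflection_square:
  fixes c x :: "'a::euclidean_jordan_algebra"
  assumes c: "jidempotent c"
  shows "peirce_reflection c x \<circ>\<^sub>J peirce_reflection c x = peirce_reflection c (x \<circ>\<^sub>J x)"
proof -
  define u where "u = peirce_half c x"
  define p where "p = x - u"
  have x: "x = p + u" by (simp add: p_def)
  have cu: "c \<circ>\<^sub>J u = (1/2) *\<^sub>R u" unfolding u_def by (rule jprod_peirce_half[OF c])
  have cp: "c \<circ>\<^sub>J (c \<circ>\<^sub>J p) = c \<circ>\<^sub>J p"
  proof (rule vector_eqI)
    fix b
    have "inner u b = 4 * inner (c \<circ>\<^sub>J x) b - 4 * inner (c \<circ>\<^sub>J (c \<circ>\<^sub>J x)) b"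
      by (simp add: u_def peirce_half_def inner_diff_left)
    then show "inner (c \<circ>\<^sub>J (c \<circ>\<^sub>J p)) b = inner (c \<circ>\<^sub>J p) b"
      by (simp add: p_def jprod.diff_right cu jprod.scaleR_right inner_diff_left field_simps)
  qed
  \<comment> \<open>\<open>p\<close> splits into c p in the 1-space and p - c p in the 0-space, and
    L(c) commutes with multiplication by each.\<close>
  have comm: "c \<circ>\<^sub>J (p \<circ>\<^sub>J y) = p \<circ>\<^sub>J (c \<circ>\<^sub>J y)" for y
  proof -
    have "c \<circ>\<^sub>J ((c \<circ>\<^sub>J p) \<circ>\<^sub>J y) = (c \<circ>\<^sub>J p) \<circ>\<^sub>J (c \<circ>\<^sub>J y)"
      by (rule peirce_one_commute[OF c cp])
    moreover have "c \<circ>\<^sub>J ((p - c \<circ>\<^sub>J p) \<circ>\<^sub>J y) = (p - c \<circ>\<^sub>J p) \<circ>\<^sub>J (c \<circ>\<^sub>J y)"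
      by (rule idempotent_orthogonal_jprod[OF c]) (simp add: jprod.diff_right cp)
    ultimately show ?thesis by (simp add: jprod.diff_left jprod.diff_right)
  qed
  have half: "peirce_half c w = w" if "c \<circ>\<^sub>J w = (1/2) *\<^sub>R w" for w
    unfolding peirce_half_def by (simp add: that jprod.scaleR_right flip: scaleR_left_diff_distrib)
  have zero: "peirce_half c w = 0" if "c \<circ>\<^sub>J (c \<circ>\<^sub>J w) = c \<circ>\<^sub>J w" for w
    by (simp add: peirce_half_def that)
  have add: "peirce_half c (v + w) = peirce_half c v + peirce_half c w" for v w
    by (simp add: peirce_half_def jprod.add_right algebra_simps)
  have pu: "peirce_half c (p \<circ>\<^sub>J u) = p \<circ>\<^sub>J u"
    by (rule half) (simp add: comm cu jprod.scaleR_right)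
  have pp: "peirce_half c (p \<circ>\<^sub>J p) = 0"
    by (rule zero) (simp add: comm cp)
  have uu: "peirce_half c (u \<circ>\<^sub>J u) = 0"
    by (rule zero[OF peirce_half_square[OF c cu]])
  have "x \<circ>\<^sub>J x = p \<circ>\<^sub>J p + u \<circ>\<^sub>J u + (p \<circ>\<^sub>J u + p \<circ>\<^sub>J u)"
    by (simp add: x jprod_simps jprod_commute[of u p])
  then have "peirce_reflection c (x \<circ>\<^sub>J x) = p \<circ>\<^sub>J p + u \<circ>\<^sub>J u - (p \<circ>\<^sub>J u + p \<circ>\<^sub>J u)"
    by (simp add: peirce_reflection_def add pp uu pu scaleR_2)
  moreover have "peirce_reflection c x = p - u"
    by (simp add: peirce_reflection_def p_def scaleR_2 flip: u_def)
  ultimately show ?thesis by (simp add: jprod_simps jprod_commute[of u p])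
qed

text \<open>The reflection is self-adjoint and can be moved to the test element, which it maps to an
  idempotent.\<close>

lemma jpositive_peirce_reflection:
  assumes c: "jidempotent c" and x: "jpositive x"
  shows "jpositive (peirce_reflection c x)"
  unfolding jpositive_def
proof (intro allI impI)
  fix f :: 'a assume "primitive_idempotent f"
  then have "jidempotent (peirce_reflection c f)"
    using primitive_idempotentD by (fastforce simp: jidempotent_def peirce_reflection_square[OF c])
  then have "0 \<le> inner x (peirce_reflection c f)" by (rule jpositive_inner_idempotent[OF x])
  also have "\<dots> = inner (peirce_reflection c x) f"
    by (simp add: peirce_reflection_def peirce_half_def inner_diff_left inner_diff_right inner_jprod[of c])
  finally show "0 \<le> inner (peirce_reflection c x) f" .
qed

lemma jpositive_sign_multiplier:
  assumes cs: "jordan_frame_list cs" and u: "jpositive u" and \<epsilon>: "\<And>i. \<epsilon> i = 1 \<or> \<epsilon> i = (-1::real)"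
  shows "jpositive (schur_multiplier cs (\<lambda>i j. \<epsilon> i * \<epsilon> j) u)"
proof -
  \<comment> \<open>\<open>\<eta>\<close> is the indicator of the indices with sign 1, and
    \<open>c\<close> is the sum of their frame members.\<close>
  define \<eta> :: "nat \<Rightarrow> real" where "\<eta> i = (1 + \<epsilon> i) / 2" for i
  have \<eta>: "\<eta> i * \<eta> i = \<eta> i" for i using \<epsilon>[of i] by (auto simp: \<eta>_def)
  define c where "c = (\<Sum>k<length cs. \<eta> k *\<^sub>R (cs ! k))"
  have mult: "c \<circ>\<^sub>J x = schur_multiplier cs (\<lambda>i j. (\<eta> i + \<eta> j) / 2) x" for x
    unfolding c_def by (rule schur_multiplier_jprod[OF cs, symmetric])
  have c: "jidempotent c"
    unfolding jidempotent_def mult by (simp add: c_def schur_multiplier_diagonal[OF cs] \<eta>)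
  \<comment> \<open>With q = (eta_i + eta_j)/2 in {0, 1/2, 1}, the entry 1 - 8 (q - q^2) is -1
    exactly for q = 1/2, that is, for opposite signs. The explicit factors 1 and -1 match
    \<open>schur_multiplier_lincomb\<close>.\<close>
  have "schur_multiplier cs (\<lambda>i j. \<epsilon> i * \<epsilon> j) u
    = schur_multiplier cs (\<lambda>i j. 1 * 1 + (-8) * (1 * ((\<eta> i + \<eta> j) / 2) + (-1) * ((\<eta> i + \<eta> j) / 2 * ((\<eta> i + \<eta> j) / 2)))) u"
  proof (rule schur_multiplier_cong)
    fix i j
    show "\<epsilon> i * \<epsilon> j = 1 * 1 + (-8) * (1 * ((\<eta> i + \<eta> j) / 2) + (-1) * ((\<eta> i + \<eta> j) / 2 * ((\<eta> i + \<eta> j) / 2)))"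
      using \<epsilon>[of i] \<epsilon>[of j] by (auto simp: \<eta>_def)
  qed
  also have "\<dots> = peirce_reflection c u"
    unfolding schur_multiplier_lincomb peirce_reflection_def peirce_half_def mult
    by (simp add: schur_multiplier_one[OF cs] schur_multiplier_mult[OF cs])
  finally show ?thesis using jpositive_peirce_reflection[OF c u] by simp
qed

lemma jpositive_rank_one:
  assumes cs: "jordan_frame_list cs" and u: "jpositive u"
  shows "jpositive (schur_multiplier cs (\<lambda>i j. v i * v j) u)"
proof -
  let ?\<epsilon> = "\<lambda>i. if v i < 0 then -1 else (1::real)"
  have "jpositive (schur_multiplier cs (\<lambda>i j. ?\<epsilon> i * ?\<epsilon> j) (schur_multiplier cs (\<lambda>i j. \<bar>v i\<bar> * \<bar>v j\<bar>) u))"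
    by (intro jpositive_sign_multiplier[OF cs] jpositive_rank_one_nonneg[OF cs u]) auto
  moreover have "?\<epsilon> i * ?\<epsilon> j * (\<bar>v i\<bar> * \<bar>v j\<bar>) = v i * v j" for i j by auto
  ultimately show ?thesis unfolding schur_multiplier_mult[OF cs] by simp
qed

text \<open>The induction passes to the Schur complement of the last diagonal entry; it needs no case distinction for
  a zero pivot because \<open>x / 0 = 0\<close>.\<close>

lemma psd_gram:
  fixes B :: "nat \<Rightarrow> nat \<Rightarrow> real"
  assumes "\<And>i j. i < n \<Longrightarrow> j < n \<Longrightarrow> B i j = B j i"
    and "\<And>x :: nat \<Rightarrow> real. 0 \<le> (\<Sum>i<n. \<Sum>j<n. x i * x j * B i j)"
  shows "\<exists>V :: nat \<Rightarrow> nat \<Rightarrow> real. \<forall>i<n. \<forall>j<n. B i j = (\<Sum>k<n. V k i * V k j)"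
  using assms
proof (induction n arbitrary: B)
  case (Suc n)
  note sym = Suc.prems(1)
  define b where "b = B n n"
  have form: "(\<Sum>i<Suc n. \<Sum>j<Suc n. x i * x j * B i j)
      = (\<Sum>i<n. \<Sum>j<n. x i * x j * B i j) + 2 * x n * (\<Sum>i<n. x i * B i n) + x n * x n * b" for x
  proof -
    have "(\<Sum>j<n. x n * x j * B n j) = x n * (\<Sum>j<n. x j * B j n)"
      using sym by (auto simp: sum_distrib_left intro!: sum.cong)
    moreover have "(\<Sum>i<n. x i * x n * B i n) = x n * (\<Sum>i<n. x i * B i n)"
      by (simp add: sum_distrib_left algebra_simps)
    ultimately show ?thesis by (simp add: sum.distrib b_def)
  qed
  have b: "0 \<le> b"
    using Suc.prems(2)[of "\<lambda>i. if i = n then 1 else 0"] unfolding form by simp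
  have zero: "B i n = 0" if "b = 0" "i < n" for i
  proof (rule ccontr)
    assume ne: "B i n \<noteq> 0"
    \<comment> \<open>Chosen so that B_ii + 2 t B_in = -1: with pivot 0 and a nonzero entry B_in the
      form is affine in the last coordinate and becomes negative.\<close>
    define t where "t = - (B i i + 1) / (2 * B i n)"
    let ?x = "\<lambda>l. if l = n then t else if l = i then 1 else 0"
    have "(\<Sum>k<n. \<Sum>j<n. ?x k * ?x j * B k j) = (\<Sum>k<n. if k = i then B i i else 0)"
    proof (intro sum.cong refl)
      fix k assume "k \<in> {..<n}"
      have "(\<Sum>j<n. ?x k * ?x j * B k j) = (\<Sum>j<n. if j = i then ?x k * B k i else 0)"
        using \<open>i < n\<close> by (intro sum.cong) auto
      then show "(\<Sum>j<n. ?x k * ?x j * B k j) = (if k = i then B i i else 0)"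
        using \<open>i < n\<close> \<open>k \<in> {..<n}\<close> by auto
    qed
    moreover have "(\<Sum>k<n. ?x k * B k n) = (\<Sum>k<n. if k = i then B i n else 0)"
      by (intro sum.cong) auto
    ultimately have "(\<Sum>k<Suc n. \<Sum>j<Suc n. ?x k * ?x j * B k j) = B i i + 2 * t * B i n"
      unfolding form using \<open>i < n\<close> \<open>b = 0\<close> by simp
    also have "\<dots> = - 1" using ne by (simp add: t_def field_simps)
    finally show False using Suc.prems(2)[of ?x] by simp
  qed
  define C where "C i j = B i j - B i n * B j n / b" for i j
  have "\<exists>V :: nat \<Rightarrow> nat \<Rightarrow> real. \<forall>i<n. \<forall>j<n. C i j = (\<Sum>k<n. V k i * V k j)"
  proof (rule Suc.IH)
    fix i j assume "i < n" "j < n"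
    then have "B i j = B j i" using sym by simp
    then show "C i j = C j i" unfolding C_def by (simp only: mult.commute)
  next
    fix x :: "nat \<Rightarrow> real"
    let ?s = "\<Sum>i<n. x i * B i n"
    \<comment> \<open>For positive \<open>b\<close> the last coordinate -s/b minimizes the form, and
      the minimum is the form of the Schur complement.\<close>
    let ?x = "x(n := - ?s / b)"
    have "(\<Sum>i<n. \<Sum>j<n. x i * x j * (B i n * B j n / b)) = ?s * ?s / b"
    proof -
      have "(\<Sum>i<n. \<Sum>j<n. x i * x j * (B i n * B j n / b)) = (\<Sum>i<n. \<Sum>j<n. (x i * B i n) * (x j * B j n) / b)"
        by (intro sum.cong refl) simp
      then show ?thesis by (simp only: sum_product sum_divide_distrib)
    qed
    then have "(\<Sum>i<n. \<Sum>j<n. x i * x j * C i j) = (\<Sum>i<n. \<Sum>j<n. x i * x j * B i j) - ?s * ?s / b"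
      by (simp add: C_def right_diff_distrib sum_subtractf)
    also have "\<dots> = (\<Sum>i<Suc n. \<Sum>j<Suc n. ?x i * ?x j * B i j)"
      unfolding form by (cases "b = 0") (auto simp: field_simps)
    finally show "0 \<le> (\<Sum>i<n. \<Sum>j<n. x i * x j * C i j)" using Suc.prems(2)[of ?x] by simp
  qed
  then obtain V :: "nat \<Rightarrow> nat \<Rightarrow> real" where V: "\<And>i j. i < n \<Longrightarrow> j < n \<Longrightarrow> C i j = (\<Sum>k<n. V k i * V k j)" by blast
  \<comment> \<open>Row \<open>n\<close> restores the rank-one matrix that the Schur complement
    removed.\<close>
  define W where "W k i = (if k = n then (if i = n then sqrt b else B i n / sqrt b) else if i = n then 0 else V k i)" for k i
  have "B i j = (\<Sum>k<Suc n. W k i * W k j)" if i: "i < Suc n" and j: "j < Suc n" for i j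
  proof -
    consider "i < n" "j < n" | "i = n" "j = n" | "i < n" "j = n" | "i = n" "j < n" using i j by linarith
    then show ?thesis
    proof cases
      case 1
      then show ?thesis using V[OF 1] b by (simp add: W_def C_def)
    next
      case 2 then show ?thesis using b by (simp add: W_def b_def)
    next
      case 3 then show ?thesis using b zero[of i] by (cases "b = 0") (auto simp: W_def)
    next
      case 4 then show ?thesis using b zero[of j] sym[of j i] by (cases "b = 0") (auto simp: W_def)
    qed
  qed
  then show ?case by blast
qed simp

lemma psd_mat_gram:
  assumes "psd_mat A" "A \<in> carrier_mat n n"
  obtains V :: "nat \<Rightarrow> nat \<Rightarrow> real" where "\<And>i j. i < n \<Longrightarrow> j < n \<Longrightarrow> A $$ (i, j) = (\<Sum>k<n. V k i * V k j)"
proof -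
  have dim: "dim_row A = n" "dim_col A = n" using assms(2) by auto
  have "A $$ (i, j) = A $$ (j, i)" if "i < n" "j < n" for i j
    using assms(1) that dim unfolding psd_mat_def by (metis index_transpose_mat(1))
  moreover have "0 \<le> (\<Sum>i<n. \<Sum>j<n. x i * x j * A $$ (i, j))" for x
  proof -
    have "0 \<le> scalar_prod (Matrix.vec n x) (A *\<^sub>v Matrix.vec n x)" using assms(1) dim by (simp add: psd_mat_def)
    also have "\<dots> = (\<Sum>i<n. \<Sum>j<n. x i * x j * A $$ (i, j))"
      by (simp add: scalar_prod_def mult_mat_vec_def dim sum_distrib_left atLeast0LessThan algebra_simps)
    finally show ?thesis .
  qed
  ultimately show ?thesis using psd_gram[of n "\<lambda>i j. A $$ (i, j)"] that by auto
qed

lemma jpositive_psd_multiplier: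
  assumes cs: "jordan_frame_list cs" and A: "psd_mat A" "A \<in> carrier_mat (length cs) (length cs)"
    and u: "jpositive u"
  shows "jpositive (schur_product cs A u)"
proof -
  obtain V where V: "\<And>i j. i < length cs \<Longrightarrow> j < length cs \<Longrightarrow> A $$ (i, j) = (\<Sum>k<length cs. V k i * V k j)"
    using psd_mat_gram[OF A] by blast
  have "schur_product cs A u = (\<Sum>k<length cs. schur_multiplier cs (\<lambda>i j. V k i * V k j) u)"
    unfolding schur_product_eq[OF cs] schur_multiplier_sum[symmetric]
    by (rule schur_multiplier_cong) (rule V)
  then show ?thesis
    using jpositive_rank_one[OF cs u] by (auto simp: jpositive_def inner_sum_left intro!: sum_nonneg)
qed

section \<open>Majorization and norms of vectors\<close>

text \<open>Abel summation: the weights decrease and the partial sums of v - w are nonnegative, so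
  replacing all weights by the last one only lowers the weighted sum of v - w.\<close>

lemma abel_sum_le:
  fixes \<xi> v w :: "nat \<Rightarrow> real"
  assumes decr: "\<And>i j. i \<le> j \<Longrightarrow> j < n \<Longrightarrow> \<xi> j \<le> \<xi> i" and nonneg: "\<And>i. i < n \<Longrightarrow> 0 \<le> \<xi> i"
    and partial: "\<And>m. m \<le> n \<Longrightarrow> (\<Sum>j<m. w j) \<le> (\<Sum>j<m. v j)"
  shows "(\<Sum>j<n. \<xi> j * w j) \<le> (\<Sum>j<n. \<xi> j * v j)"
proof -
  have *: "\<xi> m * (\<Sum>j<Suc m. v j - w j) \<le> (\<Sum>j<Suc m. \<xi> j * (v j - w j))" if "m < n" for m
    using that
  proof (induction m)
    case (Suc m)
    have "0 \<le> (\<Sum>j<Suc m. v j - w j)" using partial[of "Suc m"] Suc.prems by (simp add: sum_subtractf)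
    then have "\<xi> (Suc m) * (\<Sum>j<Suc m. v j - w j) \<le> \<xi> m * (\<Sum>j<Suc m. v j - w j)"
      using decr[of m "Suc m"] Suc.prems by (intro mult_right_mono) auto
    then show ?case using Suc by (simp add: algebra_simps)
  qed simp
  have "0 \<le> (\<Sum>j<n. \<xi> j * (v j - w j))"
  proof (cases n)
    case (Suc m)
    have "0 \<le> \<xi> m * (\<Sum>j<Suc m. v j - w j)"
      using nonneg[of m] partial[of "Suc m"] Suc by (simp add: sum_subtractf)
    then show ?thesis using *[of m] Suc by simp
  qed simp
  then show ?thesis by (simp add: right_diff_distrib sum_subtractf)
qed

text \<open>The block of the first m rows and k columns is bounded by the row and by the column
  hypothesis, so its sum is at most that of \<open>\<alpha>\<close> up to min m k. Abel summation
  over the rows with weights \<open>\<xi>\<close> then applies.\<close>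

lemma nonneg_matrix_majorization:
  fixes M :: "nat \<Rightarrow> nat \<Rightarrow> real"
  assumes M: "\<And>l i. l < n \<Longrightarrow> i < n \<Longrightarrow> 0 \<le> M l i"
    and row: "\<And>m. m \<le> n \<Longrightarrow> (\<Sum>l<m. \<Sum>i<n. M l i) \<le> (\<Sum>l<m. \<alpha> l)"
    and col: "\<And>k. k \<le> n \<Longrightarrow> (\<Sum>i<k. \<Sum>l<n. M l i) \<le> (\<Sum>i<k. \<alpha> i)"
    and decr: "\<And>i j. i \<le> j \<Longrightarrow> j < n \<Longrightarrow> \<xi> j \<le> \<xi> i" and nonneg: "\<And>i. i < n \<Longrightarrow> 0 \<le> \<xi> i"
    and k: "k \<le> n"
  shows "(\<Sum>i<k. \<Sum>l<n. \<xi> l * M l i) \<le> (\<Sum>l<k. \<xi> l * \<alpha> l)"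
proof -
  have "(\<Sum>i<k. \<Sum>l<n. \<xi> l * M l i) = (\<Sum>l<n. \<xi> l * (\<Sum>i<k. M l i))"
    by (subst sum.swap) (simp add: sum_distrib_left)
  also have "\<dots> \<le> (\<Sum>l<n. \<xi> l * (if l < k then \<alpha> l else 0))"
  proof (rule abel_sum_le[OF decr nonneg])
    fix m assume m: "m \<le> n"
    have v: "(\<Sum>l<m. if l < k then \<alpha> l else 0) = (\<Sum>l<min m k. \<alpha> l)"
    proof -
      have "(\<Sum>l<m. if l < k then \<alpha> l else 0) = (\<Sum>l\<in>{..<m} \<inter> {l. l < k}. \<alpha> l)"
        by (simp add: sum.inter_restrict)
      also have "{..<m} \<inter> {l. l < k} = {..<min m k}" by auto
      finally show ?thesis .
    qed
    show "(\<Sum>l<m. \<Sum>i<k. M l i) \<le> (\<Sum>l<m. if l < k then \<alpha> l else 0)"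
    proof (cases "m \<le> k")
      case True
      have "(\<Sum>l<m. \<Sum>i<k. M l i) \<le> (\<Sum>l<m. \<Sum>i<n. M l i)"
        using M m k by (intro sum_mono sum_mono2) auto
      then show ?thesis using row[OF m] True unfolding v by simp
    next
      case False
      have "(\<Sum>l<m. \<Sum>i<k. M l i) = (\<Sum>i<k. \<Sum>l<m. M l i)" by (rule sum.swap)
      also have "\<dots> \<le> (\<Sum>i<k. \<Sum>l<n. M l i)"
        using M m k by (intro sum_mono sum_mono2) auto
      finally show ?thesis using col[OF k] False unfolding v by simp
    qed
  qed
  also have "\<dots> = (\<Sum>l<k. \<xi> l * \<alpha> l)"
    using k by (intro sum.mono_neutral_cong_right) auto
  finally show ?thesis .
qed

text \<open>Young's inequality for the conjugate exponents t and t/(t-1), shaped so that the last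
  term can be absorbed after summation.\<close>

lemma young_powr:
  fixes p q t :: real
  assumes "1 \<le> t" "0 \<le> p" "0 \<le> q"
  shows "p powr (t - 1) * q \<le> q powr t / t + (1 - 1 / t) * p powr t"
proof (cases "t = 1")
  \<comment> \<open>There is no finite conjugate exponent here; \<open>p powr 0\<close> is 1, except
    that it is 0 for \<open>p = 0\<close>.\<close>
  case True then show ?thesis using assms by (cases "p = 0") auto
next
  case False
  then have t: "1 < t" using assms by simp
  have "q * p powr (t - 1) \<le> q powr t / t + (p powr (t - 1)) powr (t / (t - 1)) / (t / (t - 1))"
    using t assms by (intro Youngs_inequality) (auto simp: field_simps)
  also have "(p powr (t - 1)) powr (t / (t - 1)) / (t / (t - 1)) = (1 - 1 / t) * p powr t"
  proof -
    have "(t - 1) * (t / (t - 1)) = t" "1 / (t / (t - 1)) = 1 - 1 / t" using t by (simp_all add: field_simps)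
    then show ?thesis by (metis powr_powr divide_inverse inverse_eq_divide mult.commute)
  qed
  finally show ?thesis by (simp add: mult.commute)
qed

text \<open>The weights p_i^(t-1) decrease, so Abel summation bounds the sum of p^t by that of
  p^(t-1) q. Young's inequality then leaves the fraction 1 - 1/t of the left side, which is
  absorbed.\<close>

lemma weak_majorization_powr:
  fixes p q :: "nat \<Rightarrow> real"
  assumes t: "1 \<le> t"
    and decr: "\<And>i j. i \<le> j \<Longrightarrow> j < n \<Longrightarrow> p j \<le> p i"
    and p: "\<And>i. i < n \<Longrightarrow> 0 \<le> p i" and q: "\<And>i. i < n \<Longrightarrow> 0 \<le> q i"
    and partial: "\<And>m. m \<le> n \<Longrightarrow> (\<Sum>j<m. p j) \<le> (\<Sum>j<m. q j)"
  shows "(\<Sum>i<n. p i powr t) \<le> (\<Sum>i<n. q i powr t)"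
proof -
  have "(\<Sum>i<n. p i powr t) = (\<Sum>i<n. p i powr (t - 1) * p i)"
    using p by (intro sum.cong refl) (simp add: powr_mult_base mult.commute)
  also have "\<dots> \<le> (\<Sum>i<n. p i powr (t - 1) * q i)"
    using t decr p partial by (intro abel_sum_le) (auto intro: powr_mono2)
  also have "\<dots> \<le> (\<Sum>i<n. q i powr t / t + (1 - 1 / t) * p i powr t)"
    using young_powr[OF t] p q by (intro sum_mono) auto
  also have "\<dots> = (\<Sum>i<n. q i powr t) / t + (1 - 1 / t) * (\<Sum>i<n. p i powr t)"
    by (simp add: sum.distrib sum_divide_distrib sum_distrib_left)
  finally have "(\<Sum>i<n. p i powr t) / t \<le> (\<Sum>i<n. q i powr t) / t"
    by (simp add: left_diff_distrib)
  then show ?thesis using t by (simp add: divide_le_cancel)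
qed

text \<open>The weights p/r and p/s sum to 1, so the weighted arithmetic-geometric inequality
  applies to a_i^r/K and b_i^s/L, and each of these normalized families sums to 1.\<close>

lemma hoelder_sum:
  fixes a b :: "nat \<Rightarrow> real"
  assumes e: "1 \<le> p" "1 \<le> r" "1 \<le> s" "1 / p = 1 / r + 1 / s"
    and a: "\<And>i. i < n \<Longrightarrow> 0 \<le> a i" and b: "\<And>i. i < n \<Longrightarrow> 0 \<le> b i"
  shows "(\<Sum>i<n. (a i * b i) powr p) powr (1 / p)
    \<le> (\<Sum>i<n. a i powr r) powr (1 / r) * (\<Sum>i<n. b i powr s) powr (1 / s)"
proof -
  define K where "K = (\<Sum>i<n. a i powr r)"
  define L where "L = (\<Sum>i<n. b i powr s)"
  have KL: "0 \<le> K" "0 \<le> L" by (simp_all add: K_def L_def sum_nonneg)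
  show ?thesis
  proof (cases "K = 0 \<or> L = 0")
    case True
    then have "a i = 0 \<or> b i = 0" if "i < n" for i
      using that by (auto simp: K_def L_def sum_nonneg_eq_0_iff)
    then have "(\<Sum>i<n. (a i * b i) powr p) = 0" by (intro sum.neutral) auto
    then show ?thesis using e(1) by simp
  next
    case False
    then have K: "0 < K" and L: "0 < L" using KL by auto
    have pr: "p / r + p / s = 1"
    proof -
      have "p / r + p / s = p * (1 / r + 1 / s)" by (simp add: distrib_left)
      also have "\<dots> = 1" using e(1) by (simp flip: e(4))
      finally show ?thesis .
    qed
    have young: "(a i * b i) powr p \<le> (K powr (1/r) * L powr (1/s)) powr p * (p / r * (a i powr r / K) + p / s * (b i powr s / L))"
      if i: "i < n" for i
    proof (cases "a i = 0 \<or> b i = 0")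
      case True
      have "0 \<le> (K powr (1/r) * L powr (1/s)) powr p * (p / r * (a i powr r / K) + p / s * (b i powr s / L))"
        using e K L by (intro mult_nonneg_nonneg add_nonneg_nonneg) auto
      then show ?thesis using True by auto
    next
      case False
      then have ab: "0 < a i" "0 < b i" using a[OF i] b[OF i] by auto
      have "(a i powr r / K) powr (p / r) * (b i powr s / L) powr (p / s)
          \<le> p / r * (a i powr r / K) + p / s * (b i powr s / L)"
        using ab K L e pr by (intro Youngs_inequality_0) auto
      moreover have "(a i powr r / K) powr (p / r) = a i powr p / K powr (p / r)"
        "(b i powr s / L) powr (p / s) = b i powr p / L powr (p / s)"
        using ab K L e by (simp_all add: powr_divide powr_powr)
      moreover have "(K powr (1/r) * L powr (1/s)) powr p = K powr (p / r) * L powr (p / s)"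
        using K L by (simp add: powr_mult powr_powr)
      moreover have "0 < K powr (p / r) * L powr (p / s)" using K L by simp
      ultimately show ?thesis using ab by (simp add: powr_mult field_simps)
    qed
    have "(\<Sum>i<n. (a i * b i) powr p)
        \<le> (\<Sum>i<n. (K powr (1/r) * L powr (1/s)) powr p * (p / r * (a i powr r / K) + p / s * (b i powr s / L)))"
      using young by (intro sum_mono) auto
    also have "\<dots> = (K powr (1/r) * L powr (1/s)) powr p * (p / r * (K / K) + p / s * (L / L))"
      unfolding K_def L_def
      by (simp only: sum_distrib_left[symmetric] sum_divide_distrib[symmetric] sum.distrib)
    also have "\<dots> = (K powr (1/r) * L powr (1/s)) powr p" using K L pr by simp
    finally have "(\<Sum>i<n. (a i * b i) powr p) powr (1 / p) \<le> ((K powr (1/r) * L powr (1/s)) powr p) powr (1 / p)"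
      using e(1) by (intro powr_mono2) (auto intro: sum_nonneg)
    also have "\<dots> = K powr (1/r) * L powr (1/s)" using e(1) K L by (simp add: powr_powr)
    finally show ?thesis by (simp add: K_def L_def)
  qed
qed

section \<open>Vector norms with possibly infinite exponents\<close>

lemma ereal_ge_1_cases:
  assumes "1 \<le> (p::ereal)"
  obtains "p = \<infinity>" | p' where "p = ereal p'" "1 \<le> p'"
  using assms by (cases p) (auto simp: one_ereal_def)

lemma vec_norm_ereal:
  "vec_norm (ereal p) v = (\<Sum>i<length v. \<bar>v ! i\<bar> powr p) powr (1 / p)"
  by (simp add: vec_norm_def sum_list_sum_nth atLeast0LessThan)

lemma vec_norm_cong:
  assumes "mset (map abs v) = mset (map abs w)"
  shows "vec_norm p v = vec_norm p w"
proof -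
  have "set (map abs v) = set (map abs w)" using assms by (rule mset_eq_setD)
  moreover have "(\<Sum>a\<leftarrow>v. \<bar>a\<bar> powr t) = (\<Sum>a\<leftarrow>w. \<bar>a\<bar> powr t)" for t
  proof -
    have "(\<Sum>a\<leftarrow>u. \<bar>a\<bar> powr t) = \<Sum>\<^sub># (image_mset (\<lambda>a. a powr t) (mset (map abs u)))" for u :: "real list"
      by (simp add: multiset.map_comp comp_def flip: sum_mset_sum_list)
    then show ?thesis by (simp only: assms)
  qed
  ultimately show ?thesis by (simp add: vec_norm_def)
qed

lemma vec_norm_infinity_le:
  assumes "v \<noteq> []" "\<And>i. i < length v \<Longrightarrow> \<bar>v ! i\<bar> \<le> C"
  shows "vec_norm \<infinity> v \<le> C"
  using assms by (auto simp: vec_norm_def in_set_conv_nth)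

lemma vec_norm_infinity_ge: "i < length v \<Longrightarrow> \<bar>v ! i\<bar> \<le> vec_norm \<infinity> v"
  by (auto simp: vec_norm_def intro!: Max_ge)

lemma vec_norm_infinity_attained:
  assumes "v \<noteq> []"
  obtains i where "i < length v" "vec_norm \<infinity> v = \<bar>v ! i\<bar>"
proof -
  have "Max (abs ` set v) \<in> abs ` set v" using assms by (intro Max_in) auto
  then show ?thesis using that by (auto simp: vec_norm_def in_set_conv_nth)
qed

lemma vec_norm_nonneg: "v \<noteq> [] \<Longrightarrow> 0 \<le> vec_norm p v"
proof (cases "p = \<infinity>")
  case True
  assume "v \<noteq> []"
  then have "\<bar>v ! 0\<bar> \<le> vec_norm p v" using vec_norm_infinity_ge[of 0 v] True by simp
  then show ?thesis by linarith
qed (simp add: vec_norm_def)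

lemma abs_le_vec_norm:
  assumes "1 \<le> p" "i < length v"
  shows "\<bar>v ! i\<bar> \<le> vec_norm p v"
  using assms(1)
proof (cases p rule: ereal_ge_1_cases)
  case 1 then show ?thesis using vec_norm_infinity_ge[OF assms(2)] by simp
next
  case (2 t)
  have "\<bar>v ! i\<bar> powr t \<le> (\<Sum>i<length v. \<bar>v ! i\<bar> powr t)"
    using assms(2) by (intro member_le_sum) auto
  then have "(\<bar>v ! i\<bar> powr t) powr (1 / t) \<le> (\<Sum>i<length v. \<bar>v ! i\<bar> powr t) powr (1 / t)"
    using 2 by (intro powr_mono2) auto
  then show ?thesis using 2 by (simp add: vec_norm_ereal powr_powr)
qed

text \<open>Every |v_i| is at most the r-norm N, so |v_i|^s is at most N^(s-r) |v_i|^r, and these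
  bounds sum to N^s.\<close>

lemma vec_norm_antimono:
  assumes v: "v \<noteq> []" and rs: "1 \<le> r" "r \<le> s"
  shows "vec_norm s v \<le> vec_norm r v"
proof (cases "s = \<infinity>")
  case True
  then show ?thesis using abs_le_vec_norm[OF rs(1)] v by (auto intro: vec_norm_infinity_le)
next
  case False
  then obtain r' s' where e: "r = ereal r'" "s = ereal s'" "1 \<le> r'" "r' \<le> s'"
    using rs by (cases r; cases s) (auto simp: one_ereal_def)
  define N where "N = vec_norm r v"
  have N0: "0 \<le> N" using vec_norm_nonneg[OF v] by (simp add: N_def)
  have le: "\<bar>v ! i\<bar> \<le> N" if "i < length v" for i using abs_le_vec_norm[OF rs(1) that] by (simp add: N_def)
  have Nr: "N powr r' = (\<Sum>i<length v. \<bar>v ! i\<bar> powr r')"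
    using e by (simp add: N_def vec_norm_ereal powr_powr sum_nonneg)
  have "(\<Sum>i<length v. \<bar>v ! i\<bar> powr s') = (\<Sum>i<length v. \<bar>v ! i\<bar> powr (s' - r') * \<bar>v ! i\<bar> powr r')"
    by (simp flip: powr_add)
  also have "\<dots> \<le> (\<Sum>i<length v. N powr (s' - r') * \<bar>v ! i\<bar> powr r')"
    using le e by (intro sum_mono mult_right_mono powr_mono2) auto
  also have "\<dots> = N powr s'" by (simp add: sum_distrib_left[symmetric] Nr[symmetric] powr_add[symmetric])
  finally have "(\<Sum>i<length v. \<bar>v ! i\<bar> powr s') powr (1 / s') \<le> (N powr s') powr (1 / s')"
    using e by (intro powr_mono2) (auto intro: sum_nonneg)
  then show ?thesis using e N0 by (simp add: vec_norm_ereal powr_powr N_def)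
qed

lemma weak_majorization_vec_norm:
  assumes t: "1 \<le> t" and len: "length p = length q" "p \<noteq> []"
    and sorted: "sorted_wrt (\<ge>) p"
    and p: "\<And>i. i < length p \<Longrightarrow> 0 \<le> p ! i" and q: "\<And>i. i < length p \<Longrightarrow> 0 \<le> q ! i"
    and partial: "\<And>m. m \<le> length p \<Longrightarrow> (\<Sum>j<m. p ! j) \<le> (\<Sum>j<m. q ! j)"
  shows "vec_norm t p \<le> vec_norm t q"
proof -
  have decr: "p ! j \<le> p ! i" if "i \<le> j" "j < length p" for i j
    using sorted that by (cases "i = j") (auto simp: sorted_wrt_iff_nth_less)
  from t show ?thesis
  proof (cases t rule: ereal_ge_1_cases)
    case 1
    \<comment> \<open>The largest entry comes first, and the partial sum of length 1 compares p_0
      with q_0.\<close>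
    have "\<bar>p ! i\<bar> \<le> vec_norm \<infinity> q" if i: "i < length p" for i
    proof -
      have "\<bar>p ! i\<bar> \<le> p ! 0" using decr[of 0 i] p[OF i] i by simp
      also have "\<dots> \<le> q ! 0" using partial[of 1] i by simp
      also have "\<dots> \<le> vec_norm \<infinity> q"
        using vec_norm_infinity_ge[of 0 q] len by (metis abs_ge_self length_greater_0_conv order_trans)
      finally show ?thesis .
    qed
    then show ?thesis using 1 len by (auto intro: vec_norm_infinity_le)
  next
    case (2 t')
    have "(\<Sum>i<length p. (p ! i) powr t') \<le> (\<Sum>i<length p. (q ! i) powr t')"
      using 2 decr p q partial by (intro weak_majorization_powr) auto
    then have "(\<Sum>i<length p. \<bar>p ! i\<bar> powr t') \<le> (\<Sum>i<length q. \<bar>q ! i\<bar> powr t')"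
      using p q len by simp
    then show ?thesis using 2 by (simp add: vec_norm_ereal powr_mono2 sum_nonneg)
  qed
qed

lemma vec_norm_hoelder:
  assumes len: "length a = length b" "a \<noteq> []"
    and e: "1 \<le> p" "1 \<le> r" "1 \<le> s" "1 / p = 1 / r + 1 / s"
  shows "vec_norm p (map2 (*) a b) \<le> vec_norm r a * vec_norm s b"
proof -
  \<comment> \<open>The case of an infinite exponent: its reciprocal is 0, so \<open>p\<close>
    equals the other exponent.\<close>
  have inf: "vec_norm p (map2 (*) a b) \<le> vec_norm \<infinity> a * vec_norm p b"
    if len: "length a = length b" "a \<noteq> []" and p: "1 \<le> p" for a b and p :: ereal
  proof -
    have *: "\<bar>map2 (*) a b ! i\<bar> \<le> vec_norm \<infinity> a * \<bar>b ! i\<bar>" if "i < length a" for i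
      using that len vec_norm_infinity_ge[of i a] by (auto simp: abs_mult intro!: mult_right_mono)
    have a0: "0 \<le> vec_norm \<infinity> a" by (rule vec_norm_nonneg) (use len in simp)
    from p show ?thesis
    proof (cases p rule: ereal_ge_1_cases)
      case 1
      have "\<bar>map2 (*) a b ! i\<bar> \<le> vec_norm \<infinity> a * vec_norm \<infinity> b" if "i < length a" for i
        using order_trans[OF *[OF that] mult_left_mono[OF vec_norm_infinity_ge[of i b] a0]] that len by simp
      then show ?thesis unfolding 1 by (intro vec_norm_infinity_le) (use len in auto)
    next
      case (2 t)
      have "(\<Sum>i<length a. \<bar>map2 (*) a b ! i\<bar> powr t) \<le> (\<Sum>i<length a. (vec_norm \<infinity> a * \<bar>b ! i\<bar>) powr t)"
        using * 2 by (intro sum_mono powr_mono2) auto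
      also have "\<dots> = vec_norm \<infinity> a powr t * (\<Sum>i<length a. \<bar>b ! i\<bar> powr t)"
        using a0 by (simp add: powr_mult sum_distrib_left)
      finally have "(\<Sum>i<length a. \<bar>map2 (*) a b ! i\<bar> powr t) powr (1 / t)
          \<le> (vec_norm \<infinity> a powr t * (\<Sum>i<length a. \<bar>b ! i\<bar> powr t)) powr (1 / t)"
        using 2 by (intro powr_mono2) (auto intro: sum_nonneg)
      also have "\<dots> = vec_norm \<infinity> a * (\<Sum>i<length a. \<bar>b ! i\<bar> powr t) powr (1 / t)"
        using a0 2 by (simp add: powr_mult powr_powr sum_nonneg)
      finally show ?thesis using 2 len by (simp add: vec_norm_ereal)
    qed
  qed
  have comm: "map2 (*) a b = map2 (*) b a"
    using len by (intro nth_equalityI) (auto simp: mult.commute)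
  consider "r = \<infinity>" | "s = \<infinity>" | r' s' where "r = ereal r'" "1 \<le> r'" "s = ereal s'" "1 \<le> s'"
    using e(2,3) by (metis ereal_ge_1_cases)
  then show ?thesis
  proof cases
    case 1
    then have "p = s" using e by (cases p; cases s) (auto simp: one_ereal_def)
    then show ?thesis using inf[OF len e(1)] 1 by simp
  next
    case 2
    then have "p = r" using e by (cases p; cases r) (auto simp: one_ereal_def)
    moreover have "b \<noteq> []" using len by auto
    ultimately show ?thesis using inf[of b a p] len e(1) 2 by (simp add: comm mult.commute)
  next
    case 3
    have "1 / r = ereal (1 / r')" "1 / s = ereal (1 / s')" using 3 by (auto simp: one_ereal_def)
    then have sum: "1 / p = ereal (1 / r' + 1 / s')" using e(4) by simp
    moreover have "0 < 1 / r' + 1 / s'" using 3 by (intro add_pos_pos) auto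
    ultimately have "p \<noteq> \<infinity>" by auto
    then obtain p' where p: "p = ereal p'" "1 \<le> p'" using e(1) by (metis ereal_ge_1_cases)
    have "1 / p' = 1 / r' + 1 / s'" using sum p by (simp add: one_ereal_def)
    then have "(\<Sum>i<length a. (\<bar>a ! i\<bar> * \<bar>b ! i\<bar>) powr p') powr (1 / p')
        \<le> (\<Sum>i<length a. \<bar>a ! i\<bar> powr r') powr (1 / r') * (\<Sum>i<length a. \<bar>b ! i\<bar> powr s') powr (1 / s')"
      using p 3 by (intro hoelder_sum) auto
    then show ?thesis using p 3 len by (simp add: vec_norm_ereal abs_mult)
  qed
qed

section \<open>Schur products\<close>

lemma spectral_norm_spectral: "spectral_decomp x as cs \<Longrightarrow> spectral_norm t x = vec_norm t as"
  unfolding spectral_norm_def by (intro vec_norm_cong) (simp add: eigvals_eq mset_decreasing)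

lemma spectral_norm_jabs: "spectral_norm t x = vec_norm t (eigvals (jabs x))"
  unfolding spectral_norm_def
  by (intro vec_norm_cong) (simp add: eigvals_jabs mset_decreasing multiset.map_comp comp_def)

lemma sum_list_take: "k \<le> length xs \<Longrightarrow> sum_list (take k xs) = (\<Sum>i<k. xs ! i)"
  by (simp add: sum_list_sum_nth atLeast0LessThan min_absorb2)

lemma sorted_map2_mult:
  fixes p q :: "real list"
  assumes "sorted_wrt (\<ge>) p" "sorted_wrt (\<ge>) q" "length p = length q"
    and "\<And>i. i < length p \<Longrightarrow> 0 \<le> p ! i" "\<And>i. i < length p \<Longrightarrow> 0 \<le> q ! i"
  shows "sorted_wrt (\<ge>) (map2 (*) p q)"
  unfolding sorted_wrt_iff_nth_less
proof (intro allI impI)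
  fix i j assume ij: "i < j" "j < length (map2 (*) p q)"
  then have "p ! j \<le> p ! i" "q ! j \<le> q ! i"
    using assms(1-3) by (auto simp: sorted_wrt_iff_nth_less)
  then have "p ! j * q ! j \<le> p ! i * q ! i" using assms(3-5) ij by (intro mult_mono) auto
  then show "map2 (*) p q ! j \<le> map2 (*) p q ! i" using ij assms(3) by simp
qed

lemma decreasing_abs_nonneg:
  assumes "i < length p"
  shows "0 \<le> decreasing (map abs p) ! i"
proof -
  have "decreasing (map abs p) ! i \<in> set (decreasing (map abs p))"
    using assms by (intro nth_mem) (simp add: length_decreasing)
  also have "set (decreasing (map abs p)) = set (map abs p)" by (rule mset_eq_setD[OF mset_decreasing])
  finally show ?thesis by auto
qed

lemma psd_mat_diag_nonneg:
  assumes "psd_mat A" "A \<in> carrier_mat n n" "i < n"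
  shows "0 \<le> A $$ (i, i)"
proof -
  obtain V :: "nat \<Rightarrow> nat \<Rightarrow> real"
    where "\<And>i j. i < n \<Longrightarrow> j < n \<Longrightarrow> A $$ (i, j) = (\<Sum>k<n. V k i * V k j)"
    using psd_mat_gram[OF assms(1,2)] by blast
  then show ?thesis using assms(3) by (simp add: sum_nonneg)
qed

lemma schur_product_diagonal:
  "jordan_frame_list cs \<Longrightarrow>
    schur_product cs A (\<Sum>k<length cs. z k *\<^sub>R (cs ! k)) = (\<Sum>k<length cs. (A $$ (k, k) * z k) *\<^sub>R (cs ! k))"
  by (simp add: schur_product_eq schur_multiplier_diagonal)

lemma spectral_decomp_map:
  "jordan_frame_list cs \<Longrightarrow> spectral_decomp (\<Sum>k<length cs. z k *\<^sub>R (cs ! k)) (map z [0..<length cs]) cs"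
  by (simp add: spectral_decomp_def)

lemma schur_product_weak_majorization:
  fixes cs :: "'a::euclidean_jordan_algebra list"
  assumes unit: "\<And>c :: 'a. primitive_idempotent c \<Longrightarrow> inner c c = 1"
    and cs: "jordan_frame_list cs" and A: "psd_mat A" "A \<in> carrier_mat (length cs) (length cs)"
  shows "weakly_majorized (eigvals (jabs (schur_product cs A x)))
    (map2 (*) (decreasing (map abs (diag_mat A))) (eigvals (jabs x)))"
proof -
  define n where "n = length cs"
  define S where "S = schur_product cs A"
  have S_eq: "S = schur_multiplier cs (\<lambda>i j. A $$ (i, j))" using schur_product_eq[OF cs] by (auto simp: S_def)
  have lin: "linear S" unfolding S_eq by (rule linear_schur_multiplier)
  \<comment> \<open>By self-adjointness all row and column sums below are inner products with
    \<open>d\<close>, which is diagonal in the given frame with eigenvalues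
    \<open>diag_mat A\<close>.\<close>
  define d where "d = S junit"
  have diag: "diag_mat A = map (\<lambda>k. A $$ (k, k)) [0..<n]" using A(2) by (simp add: diag_mat_def n_def)
  have "d = (\<Sum>k<length cs. A $$ (k, k) *\<^sub>R (cs ! k))"
    using schur_product_diagonal[OF cs, of A "\<lambda>_. 1"] by (simp add: d_def S_def frame_list_sum[OF cs])
  then have "spectral_decomp d (diag_mat A) cs"
    using spectral_decomp_map[OF cs, of "\<lambda>k. A $$ (k, k)"] by (simp add: diag n_def)
  then obtain ds es where d: "spectral_decomp d ds es" "mset ds = mset (diag_mat A)" "sorted_wrt (\<ge>) (map id ds)"
    by (rule spectral_decomp_sorted_by[where g = id])
  \<comment> \<open>Both spectral decompositions keep the signed eigenvalues but order them by
    absolute value, to fit |x| and the absolute value of the Schur product.\<close>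
  obtain as' cs' where "spectral_decomp x as' cs'" using spectral_decomp_exists by blast
  then obtain as gs where x: "spectral_decomp x as gs" "sorted_wrt (\<ge>) (map abs as)"
    by (rule spectral_decomp_sorted_by[where g = abs])
  obtain bs' cs'' where "spectral_decomp (S x) bs' cs''" using spectral_decomp_exists by blast
  then obtain bs fs where y: "spectral_decomp (S x) bs fs" "sorted_wrt (\<ge>) (map abs bs)"
    by (rule spectral_decomp_sorted_by[where g = abs])
  note X = spectral_decompD[OF x(1)] and Y = spectral_decompD[OF y(1)] and D = spectral_decompD[OF d(1)]
  have len: "length gs = n" "length fs = n" "length es = n"
    unfolding n_def using frame_list_length_eq[OF _ cs] X Y D by auto
  have "map abs (diag_mat A) = diag_mat A"
    using psd_mat_diag_nonneg[OF A] by (simp add: diag n_def)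
  then have dec: "decreasing (map abs (diag_mat A)) = ds"
    using d(2,3) by (metis decreasing_cong decreasing_id list.map_id)
  have ds0: "0 \<le> ds ! i" if "i < n" for i
    using decreasing_abs_nonneg[of i "diag_mat A"] that unfolding dec by (simp add: diag)
  have ex: "eigvals (jabs x) = map abs as" and ey: "eigvals (jabs (S x)) = map abs bs"
    using eigvals_eq[OF jabs_spectral[OF x(1)]] eigvals_eq[OF jabs_spectral[OF y(1)]] x(2) y(2)
    by (simp_all add: decreasing_id)
  have e1: "inner c junit = 1" if "primitive_idempotent c" for c :: 'a
    using unit[OF that] idempotent_inner_junit[OF primitive_idempotentD(1)[OF that]] by simp
  have sumr: "(\<Sum>i<n. inner v (hs ! i)) = inner v junit" "(\<Sum>i<n. inner (hs ! i) v) = inner v junit"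
    if "jordan_frame_list hs" for hs :: "'a list" and v
  proof -
    have "length hs = n" unfolding n_def by (rule frame_list_length_eq[OF that cs])
    then show "(\<Sum>i<n. inner v (hs ! i)) = inner v junit" using frame_list_sum_inner[OF that, of v] by simp
    then show "(\<Sum>i<n. inner (hs ! i) v) = inner v junit" by (simp add: inner_commute)
  qed
  \<comment> \<open>The diagonal of \<open>d\<close> in any frame is majorized by its eigenvalues:
    <e_l, h_i> is doubly stochastic since every primitive idempotent has inner product 1 with
    \<open>junit\<close>, so the matrix lemma applies with all bounds 1.\<close>
  have diag_sum: "(\<Sum>i<k. inner d (hs ! i)) \<le> (\<Sum>i<k. ds ! i)" if hs: "jordan_frame_list hs" and k: "k \<le> n" for hs k
  proof -
    have lhs: "length hs = n" unfolding n_def by (rule frame_list_length_eq[OF hs cs])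
    have "(\<Sum>i<k. \<Sum>l<n. ds ! l * inner (es ! l) (hs ! i)) \<le> (\<Sum>l<k. ds ! l * 1)"
    proof (rule nonneg_matrix_majorization[OF _ _ _ _ _ k])
      show "0 \<le> inner (es ! l) (hs ! i)" if "l < n" "i < n" for l i
        using that frame_list_nth(2)[OF D(1)] frame_list_nth(2)[OF hs] len lhs
        by (intro idempotent_inner_nonneg) auto
      show "(\<Sum>l<m. \<Sum>i<n. inner (es ! l) (hs ! i)) \<le> (\<Sum>l<m. 1)" if "m \<le> n" for m
        using that len by (simp add: sumr[OF hs] e1 frame_list_nth(1)[OF D(1)])
      show "(\<Sum>i<m. \<Sum>l<n. inner (es ! l) (hs ! i)) \<le> (\<Sum>i<m. 1)" if "m \<le> n" for m
        using that lhs by (simp add: sumr[OF D(1)] e1 frame_list_nth(1)[OF hs])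
      show "ds ! j \<le> ds ! i" if "i \<le> j" "j < n" for i j
        using d(3) that D(2) len by (cases "i = j") (auto simp: sorted_wrt_iff_nth_less)
    qed (rule ds0)
    also have "(\<Sum>i<k. \<Sum>l<n. ds ! l * inner (es ! l) (hs ! i)) = (\<Sum>i<k. inner d (hs ! i))"
      using D(3) len by (simp add: inner_sum_left)
    finally show ?thesis by simp
  qed
  have self: "inner (S u) v = inner u (S v)" for u v unfolding S_eq by (rule schur_multiplier_self_adjoint[OF cs])
  have main: "(\<Sum>i<k. \<bar>bs ! i\<bar>) \<le> (\<Sum>l<k. \<bar>as ! l\<bar> * ds ! l)" if k: "k \<le> n" for k
  proof -
    let ?M = "\<lambda>l i. inner (S (gs ! l)) (fs ! i)"
    have M: "0 \<le> ?M l i" if "l < n" "i < n" for l i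
      unfolding S_def
      using that len frame_list_nth(2)[OF X(1)] frame_list_nth(2)[OF Y(1)] jpositive_idempotent
        jpositive_psd_multiplier[OF cs A] by (intro jpositive_inner_idempotent) auto
    have "\<bar>bs ! i\<bar> \<le> (\<Sum>l<n. \<bar>as ! l\<bar> * ?M l i)" if i: "i < n" for i
    proof -
      have "inner (S x) (fs ! i) = bs ! i * inner (fs ! i) (fs ! i)"
        using spectral_inner[OF Y(1), of i "(!) bs"] Y(3) i len by simp
      then have "bs ! i = inner (S x) (fs ! i)"
        using unit[OF frame_list_nth(1)[OF Y(1)]] i len by simp
      also have "S x = (\<Sum>l<n. as ! l *\<^sub>R S (gs ! l))"
        by (subst X(3)) (simp add: linear_sum[OF lin] linear_scale[OF lin] len)
      also have "inner \<dots> (fs ! i) = (\<Sum>l<n. as ! l * ?M l i)"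
        by (simp add: inner_sum_left)
      finally have "\<bar>bs ! i\<bar> \<le> (\<Sum>l<n. \<bar>as ! l * ?M l i\<bar>)" by (metis sum_abs)
      then show ?thesis using M i by (simp add: abs_mult)
    qed
    then have "(\<Sum>i<k. \<bar>bs ! i\<bar>) \<le> (\<Sum>i<k. \<Sum>l<n. \<bar>as ! l\<bar> * ?M l i)"
      using k by (intro sum_mono) auto
    also have "\<dots> \<le> (\<Sum>l<k. \<bar>as ! l\<bar> * ds ! l)"
    \<comment> \<open>Row sums of \<open>?M\<close> are <d, g_l> and column sums are <d, f_i>;
      \<open>diag_sum\<close> bounds the partial sums of both by those of \<open>ds\<close>.\<close>
    proof (rule nonneg_matrix_majorization[OF M _ _ _ _ k])
      show "(\<Sum>l<m. \<Sum>i<n. ?M l i) \<le> (\<Sum>l<m. ds ! l)" if "m \<le> n" for m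
      proof -
        have "inner (S v) junit = inner d v" for v using self[of v junit] by (simp add: d_def inner_commute)
        then show ?thesis using diag_sum[OF X(1) that] by (simp add: sumr[OF Y(1)])
      qed
      show "(\<Sum>i<m. \<Sum>l<n. ?M l i) \<le> (\<Sum>i<m. ds ! i)" if "m \<le> n" for m
      proof -
        have "(\<Sum>l<n. inner (S (gs ! l)) v) = inner d v" for v
          unfolding self[of _ v] sumr(2)[OF X(1)] using self[of v junit] by (simp add: d_def inner_commute)
        then show ?thesis using diag_sum[OF Y(1) that] by simp
      qed
      show "\<bar>as ! j\<bar> \<le> \<bar>as ! i\<bar>" if "i \<le> j" "j < n" for i j
        using x(2) that X(2) len by (cases "i = j") (auto simp: sorted_wrt_iff_nth_less)
    qed auto
    finally show ?thesis .
  qed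
  have "sorted_wrt (\<ge>) (map2 (*) ds (map abs as))"
    using d(3) x(2) X(2) D(2) len ds0 by (intro sorted_map2_mult) auto
  then show ?thesis
    unfolding weakly_majorized_def dec ex ey[unfolded S_def] decreasing_id[OF y(2)]
    using main X(2) Y(2) D(2) len
    by (auto simp: decreasing_id sum_list_take mult.commute)
qed

lemma weakly_majorized_norm_le:
  fixes x y :: "'a::euclidean_jordan_algebra"
  assumes wm: "weakly_majorized (eigvals (jabs y)) (map2 (*) (decreasing (map abs v)) (eigvals (jabs x)))"
    and v: "length v = jrank TYPE('a)" "v \<noteq> []"
    and e: "1 \<le> p" "1 \<le> r" "1 \<le> s" "1 / p = 1 / r + 1 / s"
  shows "spectral_norm p y \<le> vec_norm r v * spectral_norm s x"
proof -
  let ?P = "eigvals (jabs y)" and ?Q = "decreasing (map abs v)" and ?R = "eigvals (jabs x)"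
  have len: "length ?P = length v" "length ?Q = length v" "length ?R = length v"
    using v by (simp_all add: length_eigvals length_decreasing)
  have sorted: "sorted_wrt (\<ge>) ?P" "sorted_wrt (\<ge>) ?Q" "sorted_wrt (\<ge>) ?R"
    by (simp_all only: eigvals_jabs decreasing_sorted)
  have nonneg: "0 \<le> ?P ! i" "0 \<le> ?Q ! i" "0 \<le> ?R ! i" if "i < length v" for i
    using that v by (simp_all add: eigvals_jabs decreasing_abs_nonneg length_eigvals)
  have QR: "sorted_wrt (\<ge>) (map2 (*) ?Q ?R)"
    using sorted nonneg len by (intro sorted_map2_mult) auto
  have "vec_norm p ?P \<le> vec_norm p (map2 (*) ?Q ?R)"
  proof (rule weak_majorization_vec_norm[OF e(1)])
    fix m assume m: "m \<le> length ?P"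
    show "(\<Sum>j<m. ?P ! j) \<le> (\<Sum>j<m. map2 (*) ?Q ?R ! j)"
    \<comment> \<open>\<open>weakly_majorized\<close> speaks of partial sums from length 1 on
      only.\<close>
    proof (cases "m = 0")
      case False
      then have "sum_list (take m ?P) \<le> sum_list (take m (map2 (*) ?Q ?R))"
        using wm m unfolding weakly_majorized_def decreasing_id[OF sorted(1)] decreasing_id[OF QR] by auto
      then show ?thesis using m len by (simp add: sum_list_take)
    qed simp
  qed (use len sorted nonneg v in auto)
  also have "\<dots> \<le> vec_norm r ?Q * vec_norm s ?R"
    using len v by (intro vec_norm_hoelder e) auto
  also have "vec_norm r ?Q = vec_norm r v"
    by (rule vec_norm_cong) (simp add: mset_decreasing multiset.map_comp comp_def)
  finally show ?thesis by (simp add: spectral_norm_jabs)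
qed

section \<open>Operator norms\<close>

lemma spectral_norm_pos:
  assumes "1 \<le> t" "x \<noteq> 0"
  shows "0 < spectral_norm t x"
proof -
  obtain as cs where s: "spectral_decomp x as cs" using spectral_decomp_exists by blast
  obtain i where i: "i < length as" "as ! i \<noteq> 0"
    using assms(2) spectral_decompD[OF s] by (metis (no_types, lifting) lessThan_iff scaleR_eq_0_iff sum.neutral)
  then have "0 < \<bar>as ! i\<bar>" by simp
  also have "\<dots> \<le> vec_norm t as" by (rule abs_le_vec_norm[OF assms(1) i(1)])
  finally show ?thesis by (simp add: spectral_norm_spectral[OF s])
qed

lemma spectral_opnorm_eqI:
  assumes r: "1 \<le> r" and le: "\<And>x. spectral_norm s (T x) \<le> C * spectral_norm r x"
    and x: "x \<noteq> 0" "C * spectral_norm r x \<le> spectral_norm s (T x)"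
  shows "spectral_opnorm r s T = ereal C"
  unfolding spectral_opnorm_def
proof (rule antisym)
  show "(SUP x\<in>{x. x \<noteq> 0}. ereal (spectral_norm s (T x) / spectral_norm r x)) \<le> ereal C"
  proof (rule SUP_least)
    fix x :: 'a assume "x \<in> {x. x \<noteq> 0}"
    then have "0 < spectral_norm r x" using spectral_norm_pos[OF r] by simp
    then show "ereal (spectral_norm s (T x) / spectral_norm r x) \<le> ereal C"
      using le[of x] by (simp add: pos_divide_le_eq)
  qed
  have "ereal C \<le> ereal (spectral_norm s (T x) / spectral_norm r x)"
    using x spectral_norm_pos[OF r x(1)] by (simp add: pos_le_divide_eq)
  also have "\<dots> \<le> (SUP x\<in>{x. x \<noteq> 0}. ereal (spectral_norm s (T x) / spectral_norm r x))"
    using x by (intro SUP_upper) simp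
  finally show "ereal C \<le> (SUP x\<in>{x. x \<noteq> 0}. ereal (spectral_norm s (T x) / spectral_norm r x))" .
qed

lemma hoelder_exponent:
  assumes "1 \<le> s" "s < r"
  shows "1 \<le> hoelder_exponent r s" "1 / s = 1 / hoelder_exponent r s + 1 / r"
proof -
  obtain s' where s: "s = ereal s'" "1 \<le> s'" using assms by (cases s) (auto simp: one_ereal_def)
  have "1 \<le> hoelder_exponent r s \<and> 1 / s = 1 / hoelder_exponent r s + 1 / r"
  proof (cases "r = \<infinity>")
    case True then show ?thesis using assms by (simp add: hoelder_exponent_def)
  next
    case False
    then obtain r' where r: "r = ereal r'" "s' < r'" using assms s by (cases r) auto
    have t: "hoelder_exponent r s = ereal (r' * s' / (r' - s'))" using r s by (simp add: hoelder_exponent_def)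
    have "r' - s' \<le> r' * 1" using r s by simp
    also have "\<dots> \<le> r' * s'" using r s by (intro mult_left_mono) auto
    finally have "1 \<le> r' * s' / (r' - s')" using r by simp
    moreover have "1 / s' = 1 / (r' * s' / (r' - s')) + 1 / r'" using r s by (simp add: field_simps)
    ultimately show ?thesis unfolding t using r s by (simp add: one_ereal_def)
  qed
  then show "1 \<le> hoelder_exponent r s" "1 / s = 1 / hoelder_exponent r s + 1 / r" by auto
qed

text \<open>The upper bounds come from \<open>H\<close>, combined with monotonicity of the norms if
  r <= s. They are attained on diagonal elements, where the Schur product is entrywise
  multiplication by the diagonal of \<open>A\<close>.\<close>

lemma schur_product_opnorm:
  fixes cs :: "'a::euclidean_jordan_algebra list"
  assumes cs: "jordan_frame_list cs" and A: "A \<in> carrier_mat (length cs) (length cs)"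
    and H: "\<And>p r s :: ereal. \<And>x. 1 \<le> p \<Longrightarrow> 1 \<le> r \<Longrightarrow> 1 \<le> s \<Longrightarrow> 1 / p = 1 / r + 1 / s \<Longrightarrow>
      spectral_norm p (schur_product cs A x) \<le> vec_norm r (diag_mat A) * spectral_norm s x"
    and rs: "1 \<le> r" "1 \<le> s"
  shows "spectral_opnorm r s (schur_product cs A) =
    ereal (if r \<le> s then vec_norm \<infinity> (diag_mat A) else vec_norm (hoelder_exponent r s) (diag_mat A))"
proof -
  define n where "n = length cs"
  define \<delta> where "\<delta> k = A $$ (k, k)" for k
  have diag: "diag_mat A = map \<delta> [0..<n]" using A by (auto simp: diag_mat_def n_def \<delta>_def)
  have n: "0 < n" using frame_list_length_pos[OF cs] by (simp add: n_def)
  define X where "X z = (\<Sum>k<length cs. z k *\<^sub>R (cs ! k))" for z :: "nat \<Rightarrow> real"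
  have nX: "spectral_norm t (X z) = vec_norm t (map z [0..<n])" for t z
    unfolding X_def n_def by (rule spectral_norm_spectral[OF spectral_decomp_map[OF cs]])
  have DX: "schur_product cs A (X z) = X (\<lambda>k. \<delta> k * z k)" for z
    unfolding X_def \<delta>_def by (rule schur_product_diagonal[OF cs])
  have X0: "X z \<noteq> 0" if "k < n" "z k \<noteq> 0" for z k
  proof
    assume "X z = 0"
    then have "z k * inner (cs ! k) (cs ! k) = 0"
      using spectral_inner[OF cs, of k z] that by (simp add: X_def n_def)
    then show False using that frame_list_nth(3)[OF cs, of k] by (simp add: n_def)
  qed
  have \<delta>ne: "diag_mat A \<noteq> []" using n by (simp add: diag)
  show ?thesis
  proof (cases "r \<le> s")
    case True
    have "spectral_opnorm r s (schur_product cs A) = ereal (vec_norm \<infinity> (diag_mat A))"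
    proof -
      obtain i where i: "i < n" "vec_norm \<infinity> (diag_mat A) = \<bar>\<delta> i\<bar>"
        using vec_norm_infinity_attained[OF \<delta>ne] by (auto simp: diag)
      \<comment> \<open>The frame member at a diagonal entry of largest absolute value is
        extremal.\<close>
      let ?z = "\<lambda>k. if k = i then 1 else 0 :: real"
      have "vec_norm r (map ?z [0..<n]) = 1"
        using rs(1)
      proof (cases r rule: ereal_ge_1_cases)
        case 1
        have "vec_norm \<infinity> (map ?z [0..<n]) \<le> 1" using n by (intro vec_norm_infinity_le) auto
        moreover have "1 \<le> vec_norm \<infinity> (map ?z [0..<n])"
          using vec_norm_infinity_ge[of i "map ?z [0..<n]"] i by simp
        ultimately show ?thesis using 1 by simp
      next
        case (2 r')
        have "(\<Sum>k<n. \<bar>map ?z [0..<n] ! k\<bar> powr r') = (\<Sum>k<n. if k = i then 1 else 0)"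
          by (intro sum.cong) auto
        then show ?thesis using 2 i by (simp add: vec_norm_ereal)
      qed
      moreover have "\<bar>\<delta> i\<bar> \<le> spectral_norm s (X (\<lambda>k. \<delta> k * ?z k))"
        unfolding nX using abs_le_vec_norm[OF rs(2), of i "map (\<lambda>k. \<delta> k * ?z k) [0..<n]"] i by simp
      moreover have "spectral_norm s (schur_product cs A x) \<le> vec_norm \<infinity> (diag_mat A) * spectral_norm r x" for x
      proof -
        obtain as es where x: "spectral_decomp x as es" using spectral_decomp_exists by blast
        have "as \<noteq> []" using spectral_decompD[OF x] frame_list_length_pos by fastforce
        then have "spectral_norm s x \<le> spectral_norm r x"
          unfolding spectral_norm_spectral[OF x] by (rule vec_norm_antimono[OF _ rs(1) True])
        then have "vec_norm \<infinity> (diag_mat A) * spectral_norm s x \<le> vec_norm \<infinity> (diag_mat A) * spectral_norm r x"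
          by (intro mult_left_mono vec_norm_nonneg \<delta>ne)
        moreover have "spectral_norm s (schur_product cs A x) \<le> vec_norm \<infinity> (diag_mat A) * spectral_norm s x"
          by (rule H) (use rs in simp_all)
        ultimately show ?thesis by linarith
      qed
      ultimately show ?thesis
        using X0[OF i(1), of ?z] i(2) DX[of ?z] nX[of r ?z] by (intro spectral_opnorm_eqI[OF rs(1), of _ _ _ "X ?z"]) auto
    qed
    then show ?thesis using True by simp
  next
    case False
    then have sr: "s < r" by simp
    define t where "t = hoelder_exponent r s"
    have t: "1 \<le> t" "1 / s = 1 / t + 1 / r" using hoelder_exponent[OF rs(2) sr] by (simp_all add: t_def)
    have le: "spectral_norm s (schur_product cs A x) \<le> vec_norm t (diag_mat A) * spectral_norm r x" for x
      by (rule H[OF rs(2) t(1) rs(1) t(2)])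
    have "spectral_opnorm r s (schur_product cs A) = ereal (vec_norm t (diag_mat A))"
    \<comment> \<open>Here \<open>junit\<close> is extremal: for infinite \<open>r\<close> the
      exponent t is \<open>s\<close> and \<open>junit\<close> has norm 1; for a zero bound any
      nonzero element serves.\<close>
    proof (cases "r = \<infinity> \<or> vec_norm t (diag_mat A) = 0")
      case True
      have "vec_norm t (diag_mat A) * spectral_norm r (X (\<lambda>_. 1)) \<le> spectral_norm s (X (\<lambda>k. \<delta> k * 1))"
      proof (cases "r = \<infinity>")
        case True
        have "vec_norm \<infinity> (map (\<lambda>_. 1) [0..<n]) \<le> 1" using n by (intro vec_norm_infinity_le) auto
        then have "vec_norm t (diag_mat A) * spectral_norm r (X (\<lambda>_. 1)) \<le> vec_norm t (diag_mat A) * 1"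
          unfolding nX True by (intro mult_left_mono vec_norm_nonneg \<delta>ne)
        also have "\<dots> = spectral_norm s (X (\<lambda>k. \<delta> k * 1))"
          unfolding nX using True by (simp add: diag t_def hoelder_exponent_def)
        finally show ?thesis .
      next
        case False
        then show ?thesis
          using True n vec_norm_nonneg[of "map (\<lambda>k. \<delta> k * 1) [0..<n]" s] unfolding nX by simp
      qed
      then show ?thesis
        using X0[OF n, of "\<lambda>_. 1"] DX[of "\<lambda>_. 1"] by (intro spectral_opnorm_eqI[OF rs(1) le, of "X (\<lambda>_. 1)"]) auto
    next
      case False
      then obtain r' where r: "r = ereal r'" "1 \<le> r'" using rs(1) by (metis ereal_ge_1_cases)
      obtain s' where s: "s = ereal s'" "1 \<le> s'" using rs(2) sr by (cases s) (auto simp: one_ereal_def)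
      have "t \<noteq> \<infinity>" using r s sr by (simp add: t_def hoelder_exponent_def)
      then obtain t' where t': "t = ereal t'" "1 \<le> t'" using t(1) by (metis ereal_ge_1_cases)
      have e: "1 / s' = 1 / t' + 1 / r'" using t(2) r s t' by (simp add: one_ereal_def)
      define K where "K = (\<Sum>k<n. \<bar>\<delta> k\<bar> powr t')"
      have dK: "vec_norm t (diag_mat A) = K powr (1 / t')" by (simp add: t' vec_norm_ereal diag K_def)
      then have "K \<noteq> 0" using False by auto
      then obtain k where k: "k < n" "\<delta> k \<noteq> 0" by (auto simp: K_def elim: sum.not_neutral_contains_not_neutral)
      \<comment> \<open>The equality case of Hoelder's inequality: |z|^r is taken equal to
        |delta|^t. Then |delta z|^s is |delta|^t as well, because (1 + t/r) s = t.\<close>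
      let ?z = "\<lambda>k. \<bar>\<delta> k\<bar> powr (t' / r')"
      have "spectral_norm r (X ?z) = K powr (1 / r')"
        using r by (simp add: nX vec_norm_ereal powr_powr K_def)
      moreover have "spectral_norm s (X (\<lambda>k. \<delta> k * ?z k)) = K powr (1 / s')"
      proof -
        have "\<bar>\<delta> k * ?z k\<bar> powr s' = \<bar>\<delta> k\<bar> powr t'" for k
        proof -
          have "(1 + t' / r') * s' = t' * (1 / t' + 1 / r') * s'" using t' by (simp add: distrib_left)
          also have "\<dots> = t'" using s by (simp flip: e)
          finally have "(1 + t' / r') * s' = t'" .
          moreover have "\<bar>\<delta> k * ?z k\<bar> = \<bar>\<delta> k\<bar> powr (1 + t' / r')"
            by (cases "\<delta> k = 0") (simp_all add: abs_mult powr_add)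
          ultimately show ?thesis by (simp add: powr_powr)
        qed
        then show ?thesis using s by (simp add: nX vec_norm_ereal K_def)
      qed
      moreover have "K powr (1 / t') * K powr (1 / r') = K powr (1 / s')"
        by (simp add: e powr_add)
      ultimately show ?thesis
        using X0[OF k(1), of ?z] k(2) DX[of ?z] dK by (intro spectral_opnorm_eqI[OF rs(1) le, of "X ?z"]) auto
    qed
    then show ?thesis using False by (simp add: t_def)
  qed
qed

theorem theorem5p1:
  fixes A :: "real mat"
    and cs :: "'a::euclidean_jordan_algebra list"
    and n :: nat
  assumes trace_inner: "\<And>x y :: 'a. inner x y = jtrace (x \<circ>\<^sub>J y)"
    and rank: "jrank TYPE('a) = n"
    and A: "A \<in> carrier_mat n n" "transpose_mat A = A"
    and frame: "jordan_frame_list cs"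
  shows
    "((\<forall>x. weakly_majorized (eigvals (jabs (schur_product cs A x)))
             (map2 (*) (decreasing (map abs (diag_mat A))) (eigvals (jabs x))))
        \<longrightarrow>
        (\<forall>p r s :: ereal. 1 \<le> p \<and> 1 \<le> r \<and> 1 \<le> s \<and> 1 / p = 1 / r + 1 / s \<longrightarrow>
           (\<forall>x. spectral_norm p (schur_product cs A x)
                  \<le> vec_norm r (diag_mat A) * spectral_norm s x)) \<and>
        (\<forall>r s :: ereal. 1 \<le> r \<and> 1 \<le> s \<longrightarrow>
           spectral_opnorm r s (schur_product cs A) =
             ereal (if r \<le> s then vec_norm \<infinity> (diag_mat A)
                    else vec_norm (hoelder_exponent r s) (diag_mat A))))
     \<and>
     (psd_mat A
        \<longrightarrow>
        (\<forall>p r s :: ereal. 1 \<le> p \<and> 1 \<le> r \<and> 1 \<le> s \<and> 1 / p = 1 / r + 1 / s \<longrightarrow>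
           (\<forall>x. spectral_norm p (schur_product cs A x)
                  \<le> vec_norm r (diag_mat A) * spectral_norm s x)) \<and>
        (\<forall>r s :: ereal. 1 \<le> r \<and> 1 \<le> s \<longrightarrow>
           spectral_opnorm r s (schur_product cs A) =
             ereal (if r \<le> s then vec_norm \<infinity> (diag_mat A)
                    else vec_norm (hoelder_exponent r s) (diag_mat A))))"
proof -
  have len: "length cs = n" using frame_list_length[OF frame] rank by simp
  have A': "A \<in> carrier_mat (length cs) (length cs)" using A(1) len by simp
  have diag: "length (diag_mat A) = jrank TYPE('a)" "diag_mat A \<noteq> []"
    using A' rank len frame_list_length_pos[OF frame] by (auto simp: diag_mat_def)
  have main: "(\<forall>p r s :: ereal. 1 \<le> p \<and> 1 \<le> r \<and> 1 \<le> s \<and> 1 / p = 1 / r + 1 / s \<longrightarrow>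
           (\<forall>x. spectral_norm p (schur_product cs A x)
                  \<le> vec_norm r (diag_mat A) * spectral_norm s x)) \<and>
        (\<forall>r s :: ereal. 1 \<le> r \<and> 1 \<le> s \<longrightarrow>
           spectral_opnorm r s (schur_product cs A) =
             ereal (if r \<le> s then vec_norm \<infinity> (diag_mat A)
                    else vec_norm (hoelder_exponent r s) (diag_mat A)))"
    if wm: "\<forall>x. weakly_majorized (eigvals (jabs (schur_product cs A x)))
             (map2 (*) (decreasing (map abs (diag_mat A))) (eigvals (jabs x)))"
  proof -
    have "spectral_norm p (schur_product cs A x) \<le> vec_norm r (diag_mat A) * spectral_norm s x"
      if "1 \<le> p" "1 \<le> r" "1 \<le> s" "1 / p = 1 / r + 1 / s" for p r s :: ereal and x
      using weakly_majorized_norm_le[OF wm[rule_format] diag that] .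
    then show ?thesis using schur_product_opnorm[OF frame A'] by blast
  qed
  moreover have "\<forall>x. weakly_majorized (eigvals (jabs (schur_product cs A x)))
             (map2 (*) (decreasing (map abs (diag_mat A))) (eigvals (jabs x)))" if "psd_mat A"
    using schur_product_weak_majorization[OF primitive_inner_self[OF trace_inner] frame that A'] by blast
  ultimately show ?thesis by blast
qed

end
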